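(* Let $G$ be a group acting by homeomorphisms on a dendrite. Then either $G$ contains a non-abelian free subgroup or the action of $G$ is elementary.
   Context: A continuum is a non-empty connected compact metrisable space. A dendrite is a locally connected continuum containing no simple closed curve. An action of a group by homeomorphisms on a dendrite $X$ is elementary if the group fixes a point of $X$ or preserves (setwise) a pair of points of $X$. The alternative is not claimed to be exclusive. *)

theory Defs
  imports "HOL-Analysis.Analysis" "HOL-Algebra.Group_Action"
begin

section \<open>Dendrites\<close>

definition continuum_space :: "'a topology \<Rightarrow> bool" where
  "continuum_space X \<longleftrightarrow>
     topspace X \<noteq> {} \<and> connected_space X \<and> compact_space X \<and> metrizable_space X"

definition simple_closed_curve_in :: "'a topology \<Rightarrow> 'a set \<Rightarrow> bool" where
  "simple_closed_curve_in X C \<longleftrightarrow>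
     C \<subseteq> topspace X \<and>
     subtopology X C homeomorphic_space top_of_set (sphere (0 :: complex) 1)"

definition dendrite :: "'a topology \<Rightarrow> bool" where
  "dendrite X \<longleftrightarrow>
     continuum_space X \<and> locally_connected_space X \<and> (\<nexists>C. simple_closed_curve_in X C)"


section \<open>Actions by homeomorphisms\<close>

text \<open>
  The group is an abstract one, without topology, and the action need not be faithful.
\<close>

definition acts_by_homeomorphisms ::
    "('g, 'm) monoid_scheme \<Rightarrow> 'a topology \<Rightarrow> ('g \<Rightarrow> 'a \<Rightarrow> 'a) \<Rightarrow> bool" where
  "acts_by_homeomorphisms G X \<phi> \<longleftrightarrow>
     group_action G (topspace X) \<phi> \<and> (\<forall>g\<in>carrier G. homeomorphic_map X X (\<phi> g))"

definition elementary_action ::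
    "('g, 'm) monoid_scheme \<Rightarrow> 'a topology \<Rightarrow> ('g \<Rightarrow> 'a \<Rightarrow> 'a) \<Rightarrow> bool" where
  "elementary_action G X \<phi> \<longleftrightarrow>
     (\<exists>x\<in>topspace X. \<forall>g\<in>carrier G. \<phi> g x = x) \<or>
     (\<exists>x\<in>topspace X. \<exists>y\<in>topspace X. x \<noteq> y \<and> (\<forall>g\<in>carrier G. \<phi> g ` {x, y} = {x, y}))"


section \<open>Free groups\<close>

text \<open>
  The free group on a set \<open>S\<close> is the group of reduced words in the letters
  \<open>s\<close>, encoded as \<open>(s, True)\<close>, and \<open>s\<inverse>\<close>, encoded as \<open>(s, False)\<close>, for \<open>s\<close> in \<open>S\<close>;
  the product is concatenation followed by free reduction.
\<close>

type_synonym 's letter = "'s \<times> bool"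

definition inv_letter :: "'s letter \<Rightarrow> 's letter" where
  "inv_letter x = (fst x, \<not> snd x)"

definition reduced_word :: "'s letter list \<Rightarrow> bool" where
  "reduced_word w \<longleftrightarrow> (\<forall>i. Suc i < length w \<longrightarrow> w ! Suc i \<noteq> inv_letter (w ! i))"

definition red_cons :: "'s letter \<Rightarrow> 's letter list \<Rightarrow> 's letter list" where
  "red_cons x w = (if w \<noteq> [] \<and> hd w = inv_letter x then tl w else x # w)"

definition free_reduce :: "'s letter list \<Rightarrow> 's letter list" where
  "free_reduce w = foldr red_cons w []"

definition free_group :: "'s set \<Rightarrow> 's letter list monoid" where
  "free_group S =
     \<lparr>carrier = {w. fst ` set w \<subseteq> S \<and> reduced_word w},
      mult = (\<lambda>u v. free_reduce (u @ v)),
      one = []\<rparr>"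

text \<open>
  Indexing the basis by a set of elements of the group itself is no restriction,
  as a basis of a free group is a subset of it.
\<close>

definition is_free_group :: "('g, 'm) monoid_scheme \<Rightarrow> bool" where
  "is_free_group F \<longleftrightarrow> (\<exists>S :: 'g set. free_group S \<cong> F)"

definition contains_nonabelian_free_subgroup :: "('g, 'm) monoid_scheme \<Rightarrow> bool" where
  "contains_nonabelian_free_subgroup G \<longleftrightarrow>
     (\<exists>H. subgroup H G \<and> is_free_group (G\<lparr>carrier := H\<rparr>) \<and> \<not> comm_group (G\<lparr>carrier := H\<rparr>))"


subsection \<open>The construction yields a group\<close>

lemma inv_letter_simps [simp]:
  "inv_letter (inv_letter x) = x" "fst (inv_letter x) = fst x"
  "inv_letter x \<noteq> x" "x \<noteq> inv_letter x" "inv_letter x = inv_letter y \<longleftrightarrow> x = y"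
  by (auto simp: inv_letter_def prod_eq_iff)

lemma all_nat_split: "(\<forall>i. P i) \<longleftrightarrow> P 0 \<and> (\<forall>i. P (Suc i))"
proof safe
  fix n assume "P 0" "\<forall>i. P (Suc i)"
  then show "P n" by (cases n) auto
qed auto

lemma reduced_Nil [simp]: "reduced_word []"
  by (simp add: reduced_word_def)

lemma reduced_Cons:
  "reduced_word (x # w) \<longleftrightarrow> (w = [] \<or> hd w \<noteq> inv_letter x) \<and> reduced_word w"
proof (cases w)
  case (Cons y v)
  have "(\<forall>i. Suc i < length (x # w) \<longrightarrow> (x # w) ! Suc i \<noteq> inv_letter ((x # w) ! i)) \<longleftrightarrow>
      y \<noteq> inv_letter x \<and> (\<forall>i. Suc i < length w \<longrightarrow> w ! Suc i \<noteq> inv_letter (w ! i))"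
    (is "(\<forall>i. ?P i) \<longleftrightarrow> _")
    using all_nat_split[of ?P] Cons by simp
  then show ?thesis using Cons by (simp add: reduced_word_def)
qed (simp add: reduced_word_def)

lemma reduced_red_cons: "reduced_word w \<Longrightarrow> reduced_word (red_cons x w)"
  by (cases w) (auto simp: red_cons_def reduced_Cons)

lemma red_cons_inv: "reduced_word w \<Longrightarrow> red_cons (inv_letter x) (red_cons x w) = w"
  by (cases w) (auto simp: red_cons_def reduced_Cons)

lemma reduced_foldr: "reduced_word w \<Longrightarrow> reduced_word (foldr red_cons u w)"
  by (induction u) (auto intro: reduced_red_cons)

lemma reduced_free_reduce: "reduced_word (free_reduce w)"
  by (simp add: free_reduce_def reduced_foldr)

lemma free_reduce_id: "reduced_word w \<Longrightarrow> free_reduce w = w"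
  by (induction w) (auto simp: free_reduce_def reduced_Cons red_cons_def)

lemma foldr_red_cons:
  assumes "reduced_word w"
  shows "foldr red_cons (red_cons x u) w = red_cons x (foldr red_cons u w)"
proof (cases "u \<noteq> [] \<and> hd u = inv_letter x")
  case True
  then obtain v where u: "u = inv_letter x # v" by (cases u) auto
  have "red_cons (inv_letter (inv_letter x)) (red_cons (inv_letter x) (foldr red_cons v w)) =
      foldr red_cons v w"
    by (rule red_cons_inv) (rule reduced_foldr[OF assms])
  then show ?thesis by (simp add: u red_cons_def[of x "inv_letter x # v"])
next
  case False
  then show ?thesis by (auto simp: red_cons_def[of x u])
qed

lemma foldr_free_reduce:
  "reduced_word w \<Longrightarrow> foldr red_cons (free_reduce u) w = foldr red_cons u w"
proof (induction u)
  case (Cons x u)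
  have "free_reduce (x # u) = red_cons x (free_reduce u)" by (simp add: free_reduce_def)
  then show ?case using Cons by (simp add: foldr_red_cons)
qed (simp add: free_reduce_def)

lemma free_reduce_append: "free_reduce (u @ v) = foldr red_cons u (free_reduce v)"
  by (simp add: free_reduce_def)

lemma letters_red_cons: "fst ` set (red_cons x w) \<subseteq> insert (fst x) (fst ` set w)"
  by (cases w) (auto simp: red_cons_def)

lemma letters_free_reduce: "fst ` set (free_reduce w) \<subseteq> fst ` set w"
proof (induction w)
  case (Cons x w)
  have "free_reduce (x # w) = red_cons x (free_reduce w)" by (simp add: free_reduce_def)
  then have "fst ` set (free_reduce (x # w)) \<subseteq> insert (fst x) (fst ` set (free_reduce w))"
    using letters_red_cons[of x "free_reduce w"] by simp
  also have "\<dots> \<subseteq> fst ` set (x # w)" using Cons.IH by auto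
  finally show ?case .
qed (simp add: free_reduce_def)

lemma free_reduce_inverse: "free_reduce (rev (map inv_letter w) @ w) = []"
proof -
  have "foldr red_cons (rev (map inv_letter w)) (foldr red_cons w v) = v"
    if "reduced_word v" for v
    using that by (induction w) (auto simp: red_cons_inv reduced_foldr)
  from this[of "[]"] show ?thesis by (simp add: free_reduce_def)
qed

lemma free_reduce_assoc:
  "free_reduce (free_reduce (u @ v) @ w) = free_reduce (u @ free_reduce (v @ w))"
proof -
  have "free_reduce (free_reduce (u @ v) @ w) = foldr red_cons (u @ v) (free_reduce w)"
    by (simp only: free_reduce_append[of _ w] foldr_free_reduce[OF reduced_free_reduce])
  also have "\<dots> = foldr red_cons u (free_reduce (v @ w))"
    by (simp only: foldr_append comp_apply free_reduce_append[of v w])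
  also have "\<dots> = free_reduce (u @ free_reduce (v @ w))"
    by (simp only: free_reduce_append[of u] free_reduce_id[OF reduced_free_reduce])
  finally show ?thesis .
qed

lemma group_free_group: "group (free_group S)"
proof (rule groupI)
  fix x assume x: "x \<in> carrier (free_group S)"
  let ?y = "free_reduce (rev (map inv_letter x))"
  have "fst ` set (rev (map inv_letter x)) \<subseteq> S"
    using x by (auto simp: free_group_def)
  then have "?y \<in> carrier (free_group S)"
    using letters_free_reduce[of "rev (map inv_letter x)"]
    by (auto simp: free_group_def reduced_free_reduce)
  moreover have "?y \<otimes>\<^bsub>free_group S\<^esub> x = \<one>\<^bsub>free_group S\<^esub>"
    using free_reduce_inverse[of x]
    by (simp add: free_group_def free_reduce_append foldr_free_reduce reduced_free_reduce)
  ultimately show "\<exists>y\<in>carrier (free_group S). y \<otimes>\<^bsub>free_group S\<^esub> x = \<one>\<^bsub>free_group S\<^esub>"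
    by blast
next
  fix x y z
  show "x \<otimes>\<^bsub>free_group S\<^esub> y \<otimes>\<^bsub>free_group S\<^esub> z =
      x \<otimes>\<^bsub>free_group S\<^esub> (y \<otimes>\<^bsub>free_group S\<^esub> z)"
    by (simp add: free_group_def free_reduce_assoc)
next
  fix x y assume "x \<in> carrier (free_group S)" "y \<in> carrier (free_group S)"
  then show "x \<otimes>\<^bsub>free_group S\<^esub> y \<in> carrier (free_group S)"
    using order_trans[OF letters_free_reduce[of "x @ y"], of S]
    by (auto simp: free_group_def reduced_free_reduce image_Un)
qed (auto simp: free_group_def free_reduce_id)

end

theory Submission
  imports Defs
begin

text \<open>
  A dendrite is compact and connected, and any two of its points are separated by a third one; the
  dynamical part rests on these properties. To see the last one, suppose that no point separates \<open>a\<close> from \<open>b\<close>. Join them by an arc and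
  choose an interior point \<open>c\<close> of the arc. Some other arc joins \<open>a\<close> to \<open>b\<close> and avoids \<open>c\<close>, and the union of the two
  arcs contains a simple closed curve (\<open>arc_detour_simple_loop\<close>, \<open>dendrite_imp_dendron\<close>). The arcs exist because
  compact locally connected metric spaces are locally path connected
  (\<open>locally_connected_imp_locally_path_connected\<close>).

  A cut at \<open>w\<close> divides the complement of \<open>w\<close> into two disjoint open sets \<open>P\<close> and \<open>Q\<close>; the closed sides \<open>P \<union> {w}\<close> and
  \<open>Q \<union> {w}\<close> are connected. Cuts are therefore nested like half-spaces of a tree. Call a set convex if it
  contains every point that separates two of its points. By compactness there is a minimal non-empty
  closed convex set \<open>M\<close> that is invariant under the group. If \<open>w\<close> is a point of \<open>M\<close> and \<open>P\<close> meets \<open>M\<close>, then some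
  group element maps the complement of \<open>P\<close> into \<open>P\<close>: otherwise the translates of \<open>Q \<union> {w}\<close> would meet pairwise,
  a Helly property would give them a common point in \<open>M\<close>, and the intersection of \<open>M\<close> with all of them would be a
  smaller set of the same kind (\<open>contracting_element\<close>).

  If \<open>M\<close> is a single point, it is fixed. Otherwise look at the ends of \<open>M\<close>, the points of \<open>M\<close> that do not
  separate two other points of \<open>M\<close>. There are at least two of them (\<open>ex_end\<close>), and the group permutes them. If
  there are exactly two, they form an invariant pair. If there are three, they have disjoint
  neighbourhoods \<open>P1\<close>, \<open>P2\<close>, \<open>P3\<close> that are sides of cuts at points of \<open>M\<close>, and some elements \<open>u\<close>, \<open>v\<close>, \<open>w\<close> of the
  group push the complements of these sets into the sets. Then \<open>u v\<close> and \<open>u w\<close> play ping-pong and generate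
  a free group of rank two (\<open>ping_pong_three_players\<close>).
\<close>


section \<open>Free subgroups from ping-pong\<close>

definition (in group) letter_value :: "'a letter \<Rightarrow> 'a" where
  "letter_value x = (if snd x then fst x else inv (fst x))"

definition (in group) word_value :: "'a letter list \<Rightarrow> 'a" where
  "word_value w = foldr (\<lambda>x r. letter_value x \<otimes> r) w \<one>"

context group begin

lemma word_value_simps [simp]:
  "word_value [] = \<one>"
  "word_value (x # w) = letter_value x \<otimes> word_value w"
  by (simp_all add: word_value_def)

lemma letter_value_closed [simp]: "fst x \<in> carrier G \<Longrightarrow> letter_value x \<in> carrier G"
  by (simp add: letter_value_def)

lemma word_value_closed [simp]: "fst ` set w \<subseteq> carrier G \<Longrightarrow> word_value w \<in> carrier G"
  by (induction w) auto

lemma letter_value_inv_letter: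
  "fst x \<in> carrier G \<Longrightarrow> letter_value (inv_letter x) = inv (letter_value x)"
  by (simp add: letter_value_def inv_letter_def)

lemma word_value_append:
  "fst ` set u \<subseteq> carrier G \<Longrightarrow> fst ` set v \<subseteq> carrier G \<Longrightarrow>
    word_value (u @ v) = word_value u \<otimes> word_value v"
  by (induction u) (auto simp: m_assoc)

lemma word_value_red_cons:
  assumes "fst x \<in> carrier G" "fst ` set w \<subseteq> carrier G"
  shows "word_value (red_cons x w) = letter_value x \<otimes> word_value w"
proof (cases "w \<noteq> [] \<and> hd w = inv_letter x")
  case True
  then obtain v where w: "w = inv_letter x # v" by (cases w) auto
  then have v: "fst ` set v \<subseteq> carrier G" using assms by auto
  have "letter_value x \<otimes> (inv (letter_value x) \<otimes> word_value v) = word_value v"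
    using assms v by (simp add: m_assoc[symmetric])
  then show ?thesis using w assms by (simp add: red_cons_def letter_value_inv_letter)
qed (auto simp: red_cons_def)

lemma word_value_free_reduce:
  "fst ` set w \<subseteq> carrier G \<Longrightarrow> word_value (free_reduce w) = word_value w"
proof (induction w)
  case (Cons x w)
  have "fst ` set (free_reduce w) \<subseteq> carrier G"
    using Cons.prems letters_free_reduce[of w] by auto
  moreover have "free_reduce (x # w) = red_cons x (free_reduce w)" by (simp add: free_reduce_def)
  ultimately show ?case using Cons by (simp add: word_value_red_cons)
qed (simp add: free_reduce_def)

lemma word_value_hom:
  assumes "S \<subseteq> carrier G"
  shows "word_value \<in> hom (free_group S) G"
proof (rule homI)
  fix u v assume uv: "u \<in> carrier (free_group S)" "v \<in> carrier (free_group S)"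
  then have "fst ` set u \<subseteq> carrier G" "fst ` set v \<subseteq> carrier G"
    using assms by (auto simp: free_group_def)
  then show "word_value (u \<otimes>\<^bsub>free_group S\<^esub> v) = word_value u \<otimes> word_value v"
    by (simp add: free_group_def word_value_free_reduce word_value_append image_Un)
next
  fix u assume "u \<in> carrier (free_group S)"
  then show "word_value u \<in> carrier G"
    using assms by (intro word_value_closed) (auto simp: free_group_def)
qed

text \<open>
  The hypothesis says that the evaluation homomorphism from the free group on \<open>a\<close> and \<open>b\<close> has
  trivial kernel; so its image is free on two generators, and these do not commute.
\<close>

lemma nonabelian_free_subgroupI:
  assumes "a \<in> carrier G" "b \<in> carrier G" "a \<noteq> b"
    and free: "\<And>w. reduced_word w \<Longrightarrow> w \<noteq> [] \<Longrightarrow> fst ` set w \<subseteq> {a, b} \<Longrightarrow> word_value w \<noteq> \<one>"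
  shows "contains_nonabelian_free_subgroup G"
proof -
  let ?F = "free_group {a, b}"
  let ?H = "word_value ` carrier ?F"
  interpret F: group_hom ?F G word_value
    using assms(1,2)
    by (intro group_hom.intro group_free_group group_axioms group_hom_axioms.intro word_value_hom) auto
  have inj: "inj_on word_value (carrier ?F)"
    unfolding F.inj_on_one_iff
  proof (intro allI impI)
    fix w assume "w \<in> carrier ?F" "word_value w = \<one>"
    then show "w = \<one>\<^bsub>?F\<^esub>" using free[of w] by (auto simp: free_group_def)
  qed
  have "subgroup ?H G" by (rule F.img_is_subgroup)
  moreover have "word_value \<in> iso ?F (G\<lparr>carrier := ?H\<rparr>)"
    using inj F.homh by (auto simp: iso_def hom_def bij_betw_def)
  then have "is_free_group (G\<lparr>carrier := ?H\<rparr>)"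
    by (auto simp: is_free_group_def is_iso_def)
  moreover have "\<not> comm_group (G\<lparr>carrier := ?H\<rparr>)"
  proof
    assume "comm_group (G\<lparr>carrier := ?H\<rparr>)"
    then interpret H: comm_group "G\<lparr>carrier := ?H\<rparr>" .
    let ?a = "[(a, True)]" and ?b = "[(b, True)]"
    have ab: "?a \<in> carrier ?F" "?b \<in> carrier ?F"
      by (auto simp: free_group_def reduced_Cons)
    have "word_value (?a \<otimes>\<^bsub>?F\<^esub> ?b) = word_value (?b \<otimes>\<^bsub>?F\<^esub> ?a)"
      using H.m_comm[of "word_value ?a" "word_value ?b"] ab F.hom_mult
      by (simp del: word_value_simps)
    then have "?a \<otimes>\<^bsub>?F\<^esub> ?b = ?b \<otimes>\<^bsub>?F\<^esub> ?a"
      using inj ab by (meson F.m_closed inj_onD)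
    then show False
      using \<open>a \<noteq> b\<close> by (simp add: free_group_def free_reduce_def red_cons_def inv_letter_def)
  qed
  ultimately show ?thesis
    unfolding contains_nonabelian_free_subgroup_def by blast
qed

end

text \<open>
  Each letter \<open>x\<close> owns a set \<open>D x\<close> and throws everything outside the set of its inverse into \<open>D x\<close>.
  A reduced word therefore moves a point along its letters, from right to left, and lands it in
  the set of the first letter. There are four letters, so some set belongs neither to the first
  letter nor to the inverse of the last one. A point in that set is moved, and the word is not
  trivial.
\<close>

lemma (in group_action) ping_pong:
  assumes ab: "a \<in> carrier G" "b \<in> carrier G" "a \<noteq> b"
    and sub: "\<And>x. fst x \<in> {a, b} \<Longrightarrow> D x \<subseteq> E \<and> D x \<noteq> {}"
    and disj: "\<And>x y. fst x \<in> {a, b} \<Longrightarrow> fst y \<in> {a, b} \<Longrightarrow> x \<noteq> y \<Longrightarrow> D x \<inter> D y = {}"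
    and play: "\<And>x p. fst x \<in> {a, b} \<Longrightarrow> p \<in> E \<Longrightarrow> p \<notin> D (inv_letter x) \<Longrightarrow>
       \<phi> (group.letter_value G x) p \<in> D x"
  shows "contains_nonabelian_free_subgroup G"
proof -
  interpret group G using group_hom group_hom.axioms(1) by auto
  have main: "\<phi> (word_value w) p \<in> D (hd w)"
    if "reduced_word w" "w \<noteq> []" "fst ` set w \<subseteq> {a, b}" "p \<in> E" "p \<notin> D (inv_letter (last w))"
    for w p
    using that
  proof (induction w)
    case (Cons x w)
    have x: "fst x \<in> {a, b}" "letter_value x \<in> carrier G" using Cons.prems ab by auto
    show ?case
    proof (cases "w = []")
      case True
      then show ?thesis using Cons.prems x play[of x p] by simp
    next
      case False
      let ?q = "\<phi> (word_value w) p"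
      have w: "reduced_word w" "hd w \<noteq> inv_letter x" "fst ` set w \<subseteq> {a, b}"
        using Cons.prems False by (auto simp: reduced_Cons)
      have q: "?q \<in> D (hd w)" using Cons False w by auto
      have hw: "fst (hd w) \<in> {a, b}" using False w(3) by (cases w) auto
      have "?q \<notin> D (inv_letter x)"
        using disj[OF hw, of "inv_letter x"] q w(2) x by auto
      moreover have "?q \<in> E" using q sub[OF hw] by auto
      moreover have "word_value w \<in> carrier G"
        using w(3) ab by (intro word_value_closed) auto
      ultimately show ?thesis
        using x play[of x ?q] Cons.prems(4) by (simp add: composition_rule)
    qed
  qed simp
  show ?thesis
  proof (rule nonabelian_free_subgroupI[OF ab])
    fix w assume w: "reduced_word w" "w \<noteq> []" "fst ` set w \<subseteq> {a, b}"
    let ?L = "{(a, True), (a, False), (b, True), (b, False)}"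
    have "card ?L = 4" using ab(3) by simp
    moreover have "card {hd w, inv_letter (last w)} \<le> 2" by (simp add: card_insert_if)
    ultimately have "\<not> ?L \<subseteq> {hd w, inv_letter (last w)}"
      using card_mono[of "{hd w, inv_letter (last w)}" ?L] by auto
    then obtain y where y: "fst y \<in> {a, b}" "y \<noteq> hd w" "y \<noteq> inv_letter (last w)" by fastforce
    have hl: "fst (hd w) \<in> {a, b}" "fst (inv_letter (last w)) \<in> {a, b}"
      using w(2,3) hd_in_set[of w] last_in_set[of w] by (auto simp: subset_iff)
    obtain p where p: "p \<in> D y" "p \<in> E" using sub[OF y(1)] by auto
    have "\<phi> (word_value w) p \<in> D (hd w)"
      using main[OF w p(2)] disj[OF y(1) hl(2) y(3)] p(1) by auto
    then have "\<phi> (word_value w) p \<noteq> p"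
      using disj[OF y(1) hl(1) y(2)] p(1) by auto
    moreover have "\<phi> \<one> p = p" using p(2) id_eq_one by (metis restrict_apply')
    ultimately show "word_value w \<noteq> \<one>" by metis
  qed
qed

text \<open>
  Under this hypothesis \<open>u\<close>, \<open>v\<close>, \<open>w\<close> behave like the generators of a free product of three groups of
  order two: nothing is known about their powers, but alternating products are controlled, and
  both \<open>u\<close> and \<open>inv u\<close> push the complement of \<open>U\<close> into \<open>U\<close>. In that free product the words of even
  length form a free group on \<open>u v\<close> and \<open>u w\<close>, which suggests the two generators here.
\<close>

lemma (in group_action) ping_pong_three_players:
  assumes g: "u \<in> carrier G" "v \<in> carrier G" "w \<in> carrier G"
    and U: "U \<subseteq> E" "U \<noteq> {}" "\<And>p. p \<in> E \<Longrightarrow> p \<notin> U \<Longrightarrow> \<phi> u p \<in> U"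
    and V: "V \<subseteq> E" "V \<noteq> {}" "\<And>p. p \<in> E \<Longrightarrow> p \<notin> V \<Longrightarrow> \<phi> v p \<in> V"
    and W: "W \<subseteq> E" "W \<noteq> {}" "\<And>p. p \<in> E \<Longrightarrow> p \<notin> W \<Longrightarrow> \<phi> w p \<in> W"
    and disj: "U \<inter> V = {}" "V \<inter> W = {}" "U \<inter> W = {}"
  shows "contains_nonabelian_free_subgroup G"
proof -
  interpret group G using group_hom group_hom.axioms(1) by auto
  have inv_back: "\<phi> (inv h) (\<phi> h p) = p" if "h \<in> carrier G" "p \<in> E" for h p
    using orbit_sym_aux[OF that refl] .
  have inv_forth: "\<phi> h (\<phi> (inv h) p) = p" if "h \<in> carrier G" "p \<in> E" for h p
    using inv_back[of "inv h" p] that by simp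
  have closed: "\<phi> h p \<in> E" if "h \<in> carrier G" "p \<in> E" for h p
    using element_image[OF that refl] .
  \<comment> \<open>The preimage of a point outside \<open>V\<close> lies in \<open>V\<close>, as \<open>v\<close> throws all other points into \<open>V\<close>.\<close>
  have Vi: "\<phi> (inv v) p \<in> V" if "p \<in> E" "p \<notin> V" for p
    using V(3)[of "\<phi> (inv v) p"] that closed g inv_forth[of v p] by auto
  have Wi: "\<phi> (inv w) p \<in> W" if "p \<in> E" "p \<notin> W" for p
    using W(3)[of "\<phi> (inv w) p"] that closed g inv_forth[of w p] by auto
  have uV: "\<phi> u ` V \<subseteq> U" and uW: "\<phi> u ` W \<subseteq> U"
    using V(1) W(1) disj by (auto intro!: U(3))
  have "inj_on (\<phi> u) E" using inj_prop g by blast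
  then have uVW: "\<phi> u ` V \<inter> \<phi> u ` W = {}"
    using disj(2) V(1) W(1) by (metis image_empty inj_on_image_Int)
  let ?a = "u \<otimes> v" and ?b = "u \<otimes> w"
  have ab: "?a \<in> carrier G" "?b \<in> carrier G" using g by auto
  have "v \<noteq> w"
  proof
    assume "v = w"
    obtain p where "p \<in> U" using U by auto
    then have "p \<in> E" "p \<notin> V" "p \<notin> W" using U disj by auto
    then show False using V(3)[of p] W(3)[of p] \<open>v = w\<close> disj by auto
  qed
  then have neq: "?a \<noteq> ?b" using g by auto
  (* The inverse of u v takes a point outside u V first to a point outside V, by inv u, and then
     into V; so u V and V are the sets for u v and its inverse. Likewise for u w. *)
  define D where "D = (\<lambda>x. if x = (?a, True) then \<phi> u ` V else if x = (?a, False) then V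
      else if x = (?b, True) then \<phi> u ` W else W)"
  have D: "D (?a, True) = \<phi> u ` V" "D (?a, False) = V" "D (?b, True) = \<phi> u ` W" "D (?b, False) = W"
    using neq by (auto simp: D_def)
  have letters: "x \<in> {(?a, True), (?a, False), (?b, True), (?b, False)}" if "fst x \<in> {?a, ?b}" for x
    using that by (cases x; cases "snd x") auto
  show ?thesis
  proof (rule ping_pong[OF ab neq, of D])
    fix x :: "'a letter" assume "fst x \<in> {?a, ?b}"
    then have "x \<in> {(?a, True), (?a, False), (?b, True), (?b, False)}" by (rule letters)
    moreover have "\<phi> u ` V \<subseteq> E" "\<phi> u ` W \<subseteq> E" using uV uW U(1) by auto
    ultimately show "D x \<subseteq> E \<and> D x \<noteq> {}"
      using V(1,2) W(1,2) by (elim insertE emptyE) (simp_all add: D)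
  next
    have d: "\<phi> u ` V \<inter> V = {}" "\<phi> u ` V \<inter> W = {}" "\<phi> u ` W \<inter> V = {}" "\<phi> u ` W \<inter> W = {}"
      using uV uW disj by blast+
    fix x y :: "'a letter" assume "fst x \<in> {?a, ?b}" "fst y \<in> {?a, ?b}" and "x \<noteq> y"
    then have "x \<in> {(?a, True), (?a, False), (?b, True), (?b, False)}"
        "y \<in> {(?a, True), (?a, False), (?b, True), (?b, False)}"
      using letters by blast+
    then show "D x \<inter> D y = {}"
      using \<open>x \<noteq> y\<close> d uVW disj(2)
      by (elim insertE emptyE) (simp_all only: D Int_commute simp_thms)
  next
    fix x :: "'a letter" and p assume x: "fst x \<in> {?a, ?b}" and p: "p \<in> E" "p \<notin> D (inv_letter x)"
    consider "x = (?a, True)" | "x = (?a, False)" | "x = (?b, True)" | "x = (?b, False)"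
      using letters[OF x] by blast
    then show "\<phi> (letter_value x) p \<in> D x"
    proof cases
      case 1
      then show ?thesis using p D g V(3)[of p]
        by (simp add: letter_value_def inv_letter_def composition_rule)
    next
      case 3
      then show ?thesis using p D g W(3)[of p]
        by (simp add: letter_value_def inv_letter_def composition_rule)
    next
      case 2
      then have "p \<notin> \<phi> u ` V" using p D by (simp add: inv_letter_def)
      then have "\<phi> (inv u) p \<notin> V" using inv_forth[of u p] g p by force
      then have "\<phi> (inv v) (\<phi> (inv u) p) \<in> V" using Vi closed g p by simp
      then show ?thesis using 2 p D g
        by (simp add: letter_value_def inv_mult_group composition_rule)
    next
      case 4
      then have "p \<notin> \<phi> u ` W" using p D by (simp add: inv_letter_def)
      then have "\<phi> (inv u) p \<notin> W" using inv_forth[of u p] g p by force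
      then have "\<phi> (inv w) (\<phi> (inv u) p) \<in> W" using Wi closed g p by simp
      then show ?thesis using 4 p D g
        by (simp add: letter_value_def inv_mult_group composition_rule)
    qed
  qed
qed


section \<open>Cuts and betweenness\<close>

text \<open>
  The sides of a cut are arbitrary clopen parts of the complement of \<open>z\<close>, one of them possibly empty,
  rather than connected components; so they can be merged and intersected freely.
\<close>

definition cut :: "'a topology \<Rightarrow> 'a \<Rightarrow> 'a set \<Rightarrow> 'a set \<Rightarrow> bool" where
  "cut X z A B \<longleftrightarrow> z \<in> topspace X \<and> openin X A \<and> openin X B \<and>
     A \<inter> B = {} \<and> A \<union> B = topspace X - {z}"

definition between :: "'a topology \<Rightarrow> 'a \<Rightarrow> 'a \<Rightarrow> 'a \<Rightarrow> bool" where
  "between X a z b \<longleftrightarrow> (\<exists>A B. cut X z A B \<and> a \<in> A \<and> b \<in> B)"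

lemma cut_sym: "cut X z A B \<Longrightarrow> cut X z B A"
  by (auto simp: cut_def)

lemma cutD:
  assumes "cut X z A B"
  shows "z \<in> topspace X" "A \<subseteq> topspace X" "B \<subseteq> topspace X" "z \<notin> A" "z \<notin> B" "A \<inter> B = {}"
    "openin X A" "openin X B"
  using assms by (auto simp: cut_def)

lemma cut_cover: "cut X z A B \<Longrightarrow> x \<in> topspace X \<Longrightarrow> x \<noteq> z \<Longrightarrow> x \<notin> A \<Longrightarrow> x \<in> B"
  by (auto simp: cut_def)

lemma cut_complement: "cut X z A B \<Longrightarrow> insert z B = topspace X - A"
  by (auto simp: cut_def)

lemma closedin_cut: "cut X z A B \<Longrightarrow> closedin X (insert z B)"
  using cutD(7) cut_complement closedin_topspace by (metis closedin_diff)

text \<open>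
  If the closed side \<open>insert z A\<close> split into two relatively open pieces, the piece without \<open>z\<close> would be
  open and its complement would be the union of the other piece with \<open>B\<close>, which is open too.
\<close>

lemma connectedin_cut:
  assumes X: "connected_space X" and cut: "cut X z A B"
  shows "connectedin X (insert z A)"
proof -
  have False
    if E: "openin X E1" "openin X E2" "insert z A \<subseteq> E1 \<union> E2" "E1 \<inter> E2 \<inter> insert z A = {}"
      "E2 \<inter> insert z A \<noteq> {}" "z \<in> E1" for E1 E2
  proof -
    have "openin X (E1 \<union> B)" "openin X (E2 \<inter> A)"
      using E(1,2) cutD(7,8)[OF cut] by blast+
    moreover have "topspace X \<subseteq> (E1 \<union> B) \<union> (E2 \<inter> A)"
      using E(3,6) cut_cover[OF cut] by blast
    moreover have "(E1 \<union> B) \<inter> (E2 \<inter> A) = {}" using E(4) cutD(6)[OF cut] by blast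
    moreover have "E2 \<inter> A \<noteq> {}" using E(4,5,6) by blast
    ultimately show False using X E(6) unfolding connected_space_def by blast
  qed
  then show ?thesis
    unfolding connectedin using cutD(1,2)[OF cut]
    by (metis Int_commute Un_commute UnE insert_subset subsetD)
qed

lemma connectedin_side_of_cut:
  assumes "connectedin X C" "cut X z A B" "z \<notin> C" "C \<inter> A \<noteq> {}"
  shows "C \<subseteq> A"
proof (rule ccontr)
  assume n: "\<not> C \<subseteq> A"
  have CX: "C \<subseteq> topspace X" using assms(1) connectedin_subset_topspace by blast
  then have "C \<subseteq> A \<union> B" using assms(3) cut_cover[OF assms(2)] by blast
  moreover from this n have "B \<inter> C \<noteq> {}" by blast
  ultimately show False
    using assms(1,4) cutD(6-8)[OF assms(2)] unfolding connectedin by blast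
qed

lemma between_in_connectedin:
  assumes "connectedin X C" "a \<in> C" "b \<in> C" "between X a z b"
  shows "z \<in> C"
proof (rule ccontr)
  assume z: "z \<notin> C"
  obtain A B where "cut X z A B" "a \<in> A" "b \<in> B" using assms(4) between_def by metis
  then show False
    using connectedin_side_of_cut[OF assms(1) _ z, of A B] cutD(6)[of X z A B] assms(2,3) by blast
qed

lemma homeomorphic_map_cut:
  assumes f: "homeomorphic_map X Y f" and cut: "cut X z A B"
  shows "cut Y (f z) (f ` A) (f ` B)"
proof -
  have inj: "inj_on f (topspace X)" and surj: "f ` topspace X = topspace Y"
    using f homeomorphic_imp_injective_map homeomorphic_imp_surjective_map by blast+
  have "f ` A \<inter> f ` B = {}"
    using inj_on_image_Int[OF inj cutD(2,3)[OF cut]] cutD(6)[OF cut] by simp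
  moreover have "f ` A \<union> f ` B = topspace Y - {f z}"
    using inj_on_image_set_diff[OF inj, of "topspace X" "{z}"] cut surj
    by (simp add: cut_def flip: image_Un)
  ultimately show ?thesis
    using cutD(1,7,8)[OF cut] cutD(2,3)[OF cut] homeomorphic_map_openness[OF f] surj
    by (auto simp: cut_def)
qed

lemma homeomorphic_map_between:
  assumes "homeomorphic_map X Y f" "between X a z b"
  shows "between Y (f a) (f z) (f b)"
  using assms(2) homeomorphic_map_cut[OF assms(1)] unfolding between_def by blast

text \<open>
  Zorn's lemma for closed sets under reverse inclusion. Compactness provides a point in the
  intersection of a chain, so the family needs a lower bound for the chain only when such a point
  is given.
\<close>

lemma compact_space_minimal_closed:
  assumes "compact_space X" "\<A> \<noteq> {}"
    and closed: "\<And>A. A \<in> \<A> \<Longrightarrow> closedin X A \<and> A \<noteq> {}"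
    and lower: "\<And>\<C> x. \<C> \<noteq> {} \<Longrightarrow> \<C> \<subseteq> \<A> \<Longrightarrow> x \<in> \<Inter>\<C> \<Longrightarrow> \<exists>U\<in>\<A>. U \<subseteq> \<Inter>\<C>"
  obtains M where "M \<in> \<A>" "\<And>N. N \<in> \<A> \<Longrightarrow> N \<subseteq> M \<Longrightarrow> N = M"
proof -
  let ?c = "\<lambda>A. topspace X - A"
  have cc: "?c (?c A) = A" if "A \<in> \<A>" for A
    using closed[OF that] closedin_subset by (metis double_diff subset_refl)
  have "\<exists>M\<in>?c ` \<A>. \<forall>N\<in>?c ` \<A>. M \<subseteq> N \<longrightarrow> N = M"
  proof (rule subset_Zorn)
    fix \<D> assume \<D>: "subset.chain (?c ` \<A>) \<D>"
    show "\<exists>U\<in>?c ` \<A>. \<forall>N\<in>\<D>. N \<subseteq> U"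
    proof (cases "\<D> = {}")
      case True
      then show ?thesis using assms(2) by blast
    next
      case False
      have \<D>sub: "\<D> \<subseteq> ?c ` \<A>" and \<D>chain: "\<And>A B. A \<in> \<D> \<Longrightarrow> B \<in> \<D> \<Longrightarrow> A \<subseteq> B \<or> B \<subseteq> A"
        using \<D> by (auto simp: subset_chain_def)
      define \<C> where "\<C> = ?c ` \<D>"
      have \<C>: "\<C> \<subseteq> \<A>" "\<C> \<noteq> {}" using \<D>sub cc False by (auto simp: \<C>_def)
      have chain: "A \<subseteq> B \<or> B \<subseteq> A" if "A \<in> \<C>" "B \<in> \<C>" for A B
        using that \<D>chain unfolding \<C>_def by blast
      have least: "\<F> \<noteq> {} \<Longrightarrow> \<F> \<subseteq> \<C> \<Longrightarrow> \<Inter>\<F> \<in> \<F>" if "finite \<F>" for \<F>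
        using that
      proof (induction \<F>)
        case (insert A \<F>)
        show ?case
        proof (cases "\<F> = {}")
          case False
          then have "\<Inter>\<F> \<in> \<F>" using insert by blast
          then have "A \<subseteq> \<Inter>\<F> \<or> \<Inter>\<F> \<subseteq> A" using chain insert.prems by blast
          then have "\<Inter>(insert A \<F>) = A \<or> \<Inter>(insert A \<F>) = \<Inter>\<F>" by auto
          then show ?thesis using \<open>\<Inter>\<F> \<in> \<F>\<close> by auto
        qed simp
      qed simp
      have "\<Inter>\<C> \<noteq> {}"
      proof -
        have "\<Inter>\<F> \<noteq> {}" if "finite \<F>" "\<F> \<subseteq> \<C>" for \<F>
        proof (cases "\<F> = {}")
          case False
          then show ?thesis using least[OF that(1)] that(2) \<C>(1) closed by blast
        qed simp
        moreover have "\<forall>C\<in>\<C>. closedin X C" using \<C>(1) closed by blast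
        ultimately show ?thesis
          using assms(1)[unfolded compact_space_fip, THEN spec, of \<C>] by simp
      qed
      then obtain U where U: "U \<in> \<A>" "U \<subseteq> \<Inter>\<C>" using lower[OF \<C>(2,1)] by blast
      have "N \<subseteq> ?c U" if "N \<in> \<D>" for N
      proof -
        have "U \<subseteq> ?c N" using U(2) that unfolding \<C>_def by blast
        moreover have "N \<subseteq> topspace X" using \<D>sub that by auto
        ultimately show ?thesis by blast
      qed
      then show ?thesis using U(1) by blast
    qed
  qed
  then obtain M where M: "M \<in> \<A>" "\<forall>N\<in>?c ` \<A>. ?c M \<subseteq> N \<longrightarrow> N = ?c M" by blast
  show thesis
  proof (rule that[OF M(1)])
    fix N assume N: "N \<in> \<A>" "N \<subseteq> M"
    then have "?c N = ?c M" using M(2)[THEN bspec, OF imageI[OF N(1)]] by blast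
    then show "N = M" using cc N(1) M(1) by metis
  qed
qed


section \<open>Dendrons and their ends\<close>

text \<open>
  Compact connected spaces in which any two points are separated by a third one; the non-empty ones
  are the dendrons of general topology. Convexity, ends and group actions are studied on the basis of
  these properties alone.
\<close>

locale dendron =
  fixes X :: "'a topology"
  assumes compact: "compact_space X" and connected: "connected_space X"
    and separation: "a \<in> topspace X \<Longrightarrow> b \<in> topspace X \<Longrightarrow> a \<noteq> b \<Longrightarrow> \<exists>z. between X a z b"
begin

text \<open>
  Nesting of sides: a closed side that avoids the base point \<open>w\<close> of another cut is connected, hence lies
  on one side of that cut.
\<close>

lemma side_subset:
  assumes "cut X z A B" "cut X w P Q" "w \<notin> insert z A" "insert z A \<inter> P \<noteq> {}"
  shows "insert z A \<subseteq> P"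
  using connectedin_side_of_cut[OF connectedin_cut[OF connected assms(1)] assms(2-4)] .

text \<open>
  Two overlapping sides that avoid \<open>e\<close> lie in a common side that avoids \<open>e\<close>. For equal base points take
  the union; otherwise one of the two sides already contains the other, by nesting.

  Consequently ``some cut has \<open>e\<close> on one side and \<open>y\<close>, \<open>y'\<close> on the other'' is an equivalence relation on
  the complement of \<open>e\<close>.
\<close>

lemma cut_merge:
  assumes c: "cut X w P Q" and c': "cut X w' P' Q'" and e: "e \<in> P" "e \<in> P'" and "Q \<inter> Q' \<noteq> {}"
  shows "\<exists>v R S. cut X v R S \<and> e \<in> R \<and> Q \<union> Q' \<subseteq> S"
proof -
  consider "w = w'" | "w \<in> Q'" | "w \<in> P'"
    using cut_cover[OF c'] cutD(1)[OF c] by blast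
  then show ?thesis
  proof cases
    case 1
    have "cut X w (P \<inter> P') (Q \<union> Q')"
      using c c' 1 unfolding cut_def by (intro conjI openin_Int openin_Un) blast+
    then show ?thesis using e by blast
  next
    case 2
    then have "insert w' P' \<subseteq> P"
      using cutD(4,5,6)[OF c'] e by (intro side_subset[OF c' c]) auto
    then have "Q \<subseteq> Q'"
      using cutD(3,6)[OF c] cut_cover[OF c'] by blast
    then show ?thesis using c' e by blast
  next
    case 3
    then have "insert w' Q' \<subseteq> Q"
      using cutD(4,5,6)[OF c'] assms(5)
      by (intro side_subset[OF cut_sym[OF c'] cut_sym[OF c]]) auto
    then show ?thesis using c e by blast
  qed
qed

text \<open>
  The equivalence classes of the relation just described are open. Hence the class \<open>K\<close> of \<open>b\<close> and its
  complement form a cut at \<open>e\<close>, and \<open>e\<close> separates \<open>b\<close> from every point outside \<open>K\<close>.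
\<close>

lemma cut_off_not_between:
  assumes X: "e \<in> topspace X" "b \<in> topspace X" "c \<in> topspace X" "b \<noteq> e" "c \<noteq> e"
    and n: "\<not> between X b e c"
  shows "\<exists>w P Q. cut X w P Q \<and> e \<in> P \<and> b \<in> Q \<and> c \<in> Q"
proof (rule ccontr)
  assume neg: "\<not> ?thesis"
  define K where "K = \<Union>{Q. \<exists>w P. cut X w P Q \<and> e \<in> P \<and> b \<in> Q}"
  define L where "L = topspace X - {e} - K"
  have "openin X K" unfolding K_def by (rule openin_Union) (auto dest: cutD(8))
  moreover have "openin X L"
  proof (subst openin_subopen, intro ballI)
    fix y assume y: "y \<in> L"
    then obtain w P Q where c: "cut X w P Q" "e \<in> P" "y \<in> Q"
      using separation[of e y] X(1) by (auto simp: L_def between_def)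
    have "Q \<inter> K = {}"
    proof (rule ccontr)
      assume "Q \<inter> K \<noteq> {}"
      then obtain w' P' Q' where c': "cut X w' P' Q'" "e \<in> P'" "b \<in> Q'" "Q \<inter> Q' \<noteq> {}"
        by (auto simp: K_def)
      then have "y \<in> K"
        using cut_merge[OF c(1) c'(1) c(2) c'(2,4)] c(3) unfolding K_def by blast
      then show False using y by (simp add: L_def)
    qed
    then have "Q \<subseteq> L" using cutD(3,6)[OF c(1)] c(2) by (auto simp: L_def)
    then show "\<exists>T. openin X T \<and> y \<in> T \<and> T \<subseteq> L" using cutD(8)[OF c(1)] c(3) by blast
  qed
  moreover have "K \<subseteq> topspace X - {e}"
    by (auto simp: K_def dest: cutD)
  ultimately have "cut X e K L" using X by (auto simp: cut_def L_def)
  moreover have "b \<in> K" using separation[OF X(1,2)] X(4) by (auto simp: K_def between_def)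
  moreover have "c \<in> L" using neg X by (auto simp: L_def K_def)
  ultimately show False using n by (auto simp: between_def)
qed

lemma cut_off_finite:
  assumes "finite F" "F \<noteq> {}" "F \<subseteq> topspace X" "e \<in> topspace X" "e \<notin> F"
    and "\<And>a b. a \<in> F \<Longrightarrow> b \<in> F \<Longrightarrow> \<not> between X a e b"
  shows "\<exists>w P Q. cut X w P Q \<and> e \<in> P \<and> F \<subseteq> Q"
  using assms
proof (induction F rule: finite_ne_induct)
  case (singleton x)
  then show ?case using cut_off_not_between[of e x x] by blast
next
  case (insert x F)
  then obtain w P Q where c: "cut X w P Q" "e \<in> P" "F \<subseteq> Q" by auto
  obtain f where f: "f \<in> F" using insert by blast
  then obtain w' P' Q' where c': "cut X w' P' Q'" "e \<in> P'" "f \<in> Q'" "x \<in> Q'"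
    using cut_off_not_between[of e f x] insert.prems by blast
  then have "Q \<inter> Q' \<noteq> {}" using c f by blast
  then show ?case
    using cut_merge[OF c(1) c'(1) c(2) c'(2)] c(3) c'(4) by blast
qed

lemma between_trans:
  assumes "between X p x y" "between X p y v"
  shows "between X p x v"
proof -
  obtain P Q P' Q' where c: "cut X x P Q" "p \<in> P" "y \<in> Q" and c': "cut X y P' Q'" "p \<in> P'" "v \<in> Q'"
    using assms unfolding between_def by blast
  have "insert x P \<subseteq> P'"
    using c c'(2) cutD(5,6)[OF c(1)] by (intro side_subset[OF c(1) c'(1)]) auto
  then have "v \<in> Q"
    using c'(3) cutD(3,6)[OF c'(1)] cut_cover[OF c(1), of v] by blast
  then show ?thesis using c between_def by metis
qed

definition ends :: "'a set \<Rightarrow> 'a set" where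
  "ends M = {e \<in> M. \<forall>a\<in>M. \<forall>b\<in>M. \<not> between X a e b}"

text \<open>
  Walk away from \<open>p\<close> as far as possible. Let \<open>T x\<close> be the part of \<open>M\<close> that lies behind \<open>x\<close> as seen from
  \<open>p\<close>. These sets are closed, because a point not behind \<open>x\<close> can be cut off from \<open>x\<close> together with \<open>p\<close>,
  and \<open>T y\<close> is contained in \<open>T x\<close> whenever \<open>y\<close> lies in \<open>T x\<close>. A minimal \<open>T e\<close> is \<open>{e}\<close>: nothing of \<open>M\<close> is behind
  \<open>e\<close>. Then \<open>e\<close> separates no two points of \<open>M\<close>, as it would separate one of them from \<open>p\<close>.
\<close>

lemma ex_end:
  assumes M: "closedin X M" and p: "p \<in> M" "M \<noteq> {p}"
  shows "\<exists>e\<in>ends M. e \<noteq> p"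
proof -
  have MX: "M \<subseteq> topspace X" using M closedin_subset by blast
  define T where "T x = {y \<in> M. y = x \<or> between X p x y}" for x
  have T_closed: "closedin X (T x)" if x: "x \<in> M" "x \<noteq> p" for x
  proof -
    define W where "W = \<Union>{Q. \<exists>w P. cut X w P Q \<and> x \<in> P \<and> p \<in> Q}"
    have "openin X W" unfolding W_def by (rule openin_Union) (auto dest: cutD(8))
    moreover have "T x = M - W"
    proof (intro equalityI subsetI)
      fix y assume y: "y \<in> T x"
      have "y \<notin> Q" if c: "cut X w P Q" "x \<in> P" "p \<in> Q" for w P Q
      proof
        assume "y \<in> Q"
        moreover have "x \<notin> insert w Q" using c cutD(4,6)[OF c(1)] by auto
        ultimately show False
          using between_in_connectedin[OF connectedin_cut[OF connected cut_sym[OF c(1)]], of p y x] c y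
          by (auto simp: T_def)
      qed
      then show "y \<in> M - W" using y by (auto simp: T_def W_def)
    next
      fix y assume y: "y \<in> M - W"
      show "y \<in> T x"
      proof (rule ccontr)
        assume "y \<notin> T x"
        then have "y \<noteq> x" "\<not> between X p x y" using y by (auto simp: T_def)
        then show False
          using cut_off_not_between[of x p y] y x MX p(1) unfolding W_def by blast
      qed
    qed
    ultimately show ?thesis using M by (simp add: closedin_diff)
  qed
  have p_T: "p \<notin> T x" if "x \<noteq> p" for x
    using that by (auto simp: T_def between_def dest: cutD(6))
  have T_mono: "T y \<subseteq> T x" if "y \<in> T x" for x y
    using that between_trans by (auto simp: T_def)
  obtain M' where M': "M' \<in> T ` (M - {p})"
    and min: "\<And>N. N \<in> T ` (M - {p}) \<Longrightarrow> N \<subseteq> M' \<Longrightarrow> N = M'"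
  proof (rule compact_space_minimal_closed[OF compact, of "T ` (M - {p})"])
    show "T ` (M - {p}) \<noteq> {}" using p by blast
    show "closedin X A \<and> A \<noteq> {}" if "A \<in> T ` (M - {p})" for A
      using that T_closed by (auto simp: T_def)
    show "\<exists>U\<in>T ` (M - {p}). U \<subseteq> \<Inter>\<C>"
      if \<C>: "\<C> \<noteq> {}" "\<C> \<subseteq> T ` (M - {p})" "x \<in> \<Inter>\<C>" for \<C> x
    proof (intro bexI[of _ "T x"])
      show "T x \<subseteq> \<Inter>\<C>"
      proof (rule Inter_greatest)
        fix C assume "C \<in> \<C>"
        then obtain y where "C = T y" "x \<in> T y" using \<C>(2,3) by blast
        then show "T x \<subseteq> C" using T_mono by blast
      qed
      obtain C where "C \<in> \<C>" using \<C>(1) by blast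
      then have "C \<in> T ` (M - {p})" "x \<in> C" using \<C>(2,3) by blast+
      then obtain y where "y \<noteq> p" "x \<in> T y" by blast
      then have "x \<in> M" "x \<noteq> p" using p_T[of y] by (auto simp: T_def)
      then show "T x \<in> T ` (M - {p})" by blast
    qed
  qed blast
  then obtain e where e: "e \<in> M" "e \<noteq> p" "M' = T e" by blast
  have Te: "y = e" if "y \<in> T e" for y
  proof -
    have "y \<in> M - {p}" using that p_T[OF e(2)] by (auto simp: T_def)
    then have "T y = T e" using min[of "T y"] T_mono[OF that] e(3) by blast
    then have "e = y \<or> between X p y e" using e(1) by (auto simp: T_def)
    moreover have "y = e \<or> between X p e y" using that by (auto simp: T_def)
    moreover have "\<not> between X p e e" by (auto simp: between_def dest: cutD)
    ultimately show ?thesis using between_trans by blast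
  qed
  have no: "\<not> between X p e y" if "y \<in> M" for y
    using Te[of y] that by (auto simp: T_def between_def dest: cutD)
  have "\<not> between X a e b" if ab: "a \<in> M" "b \<in> M" for a b
  proof
    assume "between X a e b"
    then obtain A B where c: "cut X e A B" "a \<in> A" "b \<in> B" by (auto simp: between_def)
    then have "p \<in> A \<or> p \<in> B" using p(1) MX e(2) cut_cover[OF c(1), of p] by auto
    then show False
    proof
      assume "p \<in> A"
      then show False using c no[OF ab(2)] unfolding between_def by blast
    next
      assume "p \<in> B"
      then show False using c no[OF ab(1)] cut_sym[OF c(1)] unfolding between_def by blast
    qed
  qed
  then show ?thesis using e by (auto simp: ends_def)
qed

end


section \<open>Group actions on dendrons\<close>

locale dendron_action = dendron X + group_action G "topspace X" \<phi>
  for X :: "'a topology" and G (structure) and \<phi> +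
  assumes homeo: "g \<in> carrier G \<Longrightarrow> homeomorphic_map X X (\<phi> g)"
begin

sublocale group G
  using group_hom group_hom.axioms(1) by auto

text \<open>
  Convexity means that every point separating two points of \<open>M\<close> belongs to \<open>M\<close>. It replaces
  connectedness of \<open>M\<close>: it passes to intersections trivially, and it keeps the base points of cuts that
  separate points of \<open>M\<close> inside \<open>M\<close>.
\<close>

definition invariant_convex :: "'a set \<Rightarrow> bool" where
  "invariant_convex M \<longleftrightarrow> closedin X M \<and> M \<noteq> {} \<and>
     (\<forall>a\<in>M. \<forall>b\<in>M. \<forall>z. between X a z b \<longrightarrow> z \<in> M) \<and> (\<forall>g\<in>carrier G. \<phi> g ` M \<subseteq> M)"

definition minimal_invariant :: "'a set \<Rightarrow> bool" where
  "minimal_invariant M \<longleftrightarrow> invariant_convex M \<and> (\<forall>N. invariant_convex N \<longrightarrow> N \<subseteq> M \<longrightarrow> N = M)"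

lemma act_inv: "g \<in> carrier G \<Longrightarrow> x \<in> topspace X \<Longrightarrow> \<phi> (inv g) (\<phi> g x) = x"
  using orbit_sym_aux by blast

lemma act_inv': "g \<in> carrier G \<Longrightarrow> x \<in> topspace X \<Longrightarrow> \<phi> g (\<phi> (inv g) x) = x"
  using act_inv[of "inv g" x] by simp

lemma ex_minimal_invariant:
  assumes "topspace X \<noteq> {}"
  obtains M where "minimal_invariant M"
proof -
  obtain M where "M \<in> Collect invariant_convex"
    and "\<And>N. N \<in> Collect invariant_convex \<Longrightarrow> N \<subseteq> M \<Longrightarrow> N = M"
  proof (rule compact_space_minimal_closed[OF compact, of "Collect invariant_convex"])
    have "invariant_convex (topspace X)"
      unfolding invariant_convex_def
    proof (intro conjI ballI allI impI)
      show "z \<in> topspace X" if "between X a z b" for a z b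
        using that by (auto simp: between_def dest: cutD(1))
    qed (use assms surj_prop in simp_all)
    then show "Collect invariant_convex \<noteq> {}" by blast
    show "closedin X A \<and> A \<noteq> {}" if "A \<in> Collect invariant_convex" for A
      using that by (simp add: invariant_convex_def)
    show "\<exists>U\<in>Collect invariant_convex. U \<subseteq> \<Inter>\<C>"
      if "\<C> \<noteq> {}" "\<C> \<subseteq> Collect invariant_convex" "x \<in> \<Inter>\<C>" for \<C> x
    proof
      show "\<Inter>\<C> \<in> Collect invariant_convex"
        unfolding mem_Collect_eq invariant_convex_def
      proof (intro conjI ballI allI impI)
        show "closedin X (\<Inter>\<C>)"
          using that by (intro closedin_Inter) (auto simp: invariant_convex_def)
        show "\<Inter>\<C> \<noteq> {}" using that by blast
        show "z \<in> \<Inter>\<C>" if "a \<in> \<Inter>\<C>" "b \<in> \<Inter>\<C>" "between X a z b" for a b z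
          using that \<open>\<C> \<subseteq> _\<close> unfolding invariant_convex_def by blast
        show "\<phi> g ` \<Inter>\<C> \<subseteq> \<Inter>\<C>" if "g \<in> carrier G" for g
          using that \<open>\<C> \<subseteq> _\<close> unfolding invariant_convex_def by blast
      qed
    qed simp
  qed blast
  then show thesis using that by (auto simp: minimal_invariant_def)
qed

text \<open>
  A Helly argument for half-spaces. Suppose every translate of the closed side \<open>insert w Q\<close> meets that
  side; then any two translates meet. If finitely many translates of \<open>P\<close> covered \<open>M\<close>, take a maximal one
  among them, \<open>\<phi> j ` P\<close>. Its base point \<open>\<phi> j w\<close> belongs to \<open>M\<close>, hence to some other translate \<open>\<phi> i ` P\<close>; as
  the complementary closed sides meet, nesting makes \<open>\<phi> i ` P\<close> strictly larger, a contradiction. By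
  compactness the translates of \<open>insert w Q\<close> have a common point in \<open>M\<close>, and their intersection with \<open>M\<close> is a
  smaller invariant convex set, against minimality.

  The resulting \<open>g\<close> moves the closed side off itself, that is, into \<open>P\<close>.
\<close>

lemma contracting_element:
  assumes M: "minimal_invariant M" and c: "cut X w P Q" and w: "w \<in> M" and PM: "P \<inter> M \<noteq> {}"
  shows "\<exists>g\<in>carrier G. \<forall>x\<in>topspace X - P. \<phi> g x \<in> P"
proof (rule ccontr)
  assume neg: "\<not> ?thesis"
  let ?C = "insert w Q"
  have C: "?C = topspace X - P" using cut_complement[OF c] .
  have CX: "?C \<subseteq> topspace X" using C by auto
  have icM: "invariant_convex M" using M by (simp add: minimal_invariant_def)
  have clM: "closedin X M" using icM by (simp add: invariant_convex_def)
  have convM: "z \<in> M" if "a \<in> M" "b \<in> M" "between X a z b" for a b z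
    using icM that unfolding invariant_convex_def by blast
  have invM: "\<phi> g x \<in> M" if "g \<in> carrier G" "x \<in> M" for g x
    using icM that unfolding invariant_convex_def by blast
  have ic: "cut X (\<phi> g w) (\<phi> g ` P) (\<phi> g ` Q)" if "g \<in> carrier G" for g
    using homeomorphic_map_cut[OF homeo[OF that] c] .
  have conn: "connectedin X (\<phi> g ` ?C)" if "g \<in> carrier G" for g
    using connectedin_cut[OF connected cut_sym[OF ic[OF that]]] by simp
  have clos: "closedin X (\<phi> g ` ?C)" if "g \<in> carrier G" for g
    using closedin_cut[OF ic[OF that]] by simp
  have meet: "\<phi> g ` ?C \<inter> \<phi> h ` ?C \<noteq> {}" if gh: "g \<in> carrier G" "h \<in> carrier G" for g h
  proof -
    let ?k = "inv g \<otimes> h"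
    have k: "?k \<in> carrier G" using gh by simp
    then obtain x where x: "x \<in> ?C" "\<phi> ?k x \<notin> P" using neg C by blast
    have xX: "x \<in> topspace X" using x CX by blast
    then have "\<phi> ?k x \<in> ?C" using x(2) element_image[OF k xX refl] C by blast
    moreover have "\<phi> g (\<phi> ?k x) = \<phi> h x"
      using gh xX element_image[OF gh(2) xX refl] by (simp add: composition_rule act_inv')
    ultimately show ?thesis using x(1) by (metis IntI emptyE imageI)
  qed
  define N where "N = M \<inter> (\<Inter>g\<in>carrier G. \<phi> g ` ?C)"
  have ND: "x \<in> \<phi> g ` ?C" if "x \<in> N" "g \<in> carrier G" for x g
    using that unfolding N_def by (metis INT_E IntD2)
  have "N \<noteq> {}"
  proof
    assume N: "N = {}"
    define \<U> where "\<U> = insert M ((\<lambda>g. \<phi> g ` ?C) ` carrier G)"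
    have "\<Inter>\<U> = {}" using N by (simp add: N_def \<U>_def)
    moreover have "\<forall>A\<in>\<U>. closedin X A"
      using clos clM by (auto simp: \<U>_def)
    ultimately obtain \<F> where \<F>: "finite \<F>" "\<F> \<subseteq> \<U>" "\<Inter>\<F> = {}"
      using compact[unfolded compact_space_fip, THEN spec, of \<U>] by auto
    have "\<F> - {M} \<subseteq> (\<lambda>g. \<phi> g ` ?C) ` carrier G" using \<F>(2) unfolding \<U>_def by blast
    then obtain K where K: "K \<subseteq> carrier G" "finite K" "\<F> - {M} = (\<lambda>g. \<phi> g ` ?C) ` K"
      using finite_subset_image[of "\<F> - {M}"] \<F>(1) by (metis finite_Diff)
    have "M \<inter> (\<Inter>g\<in>K. \<phi> g ` ?C) \<subseteq> \<Inter>\<F>"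
      unfolding K(3)[symmetric] by blast
    then have empty: "M \<inter> (\<Inter>g\<in>K. \<phi> g ` ?C) = {}" unfolding \<F>(3) by simp
    then have "K \<noteq> {}" using w by auto
    then obtain B where B: "B \<in> (\<lambda>g. \<phi> g ` P) ` K" "\<forall>A\<in>(\<lambda>g. \<phi> g ` P) ` K. B \<le> A \<longrightarrow> B = A"
      using finite_has_maximal[of "(\<lambda>g. \<phi> g ` P) ` K"] K(2) by blast
    then obtain j where j: "j \<in> K" "B = \<phi> j ` P" by blast
    have max: "\<phi> j ` P = \<phi> i ` P" if "i \<in> K" "\<phi> j ` P \<subseteq> \<phi> i ` P" for i
      using B(2) that unfolding j(2) by blast
    have jG: "j \<in> carrier G" using j(1) K by blast
    have jw: "\<phi> j w \<in> M" using invM[OF jG w] .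
    then obtain i where i: "i \<in> K" "\<phi> j w \<notin> \<phi> i ` ?C" using empty by blast
    have iG: "i \<in> carrier G" using i K by blast
    have "\<phi> i ` ?C \<inter> \<phi> j ` Q \<noteq> {}" using meet[OF iG jG] i(2) by auto
    then have sub: "\<phi> i ` ?C \<subseteq> \<phi> j ` Q"
      using connectedin_side_of_cut[OF conn[OF iG] cut_sym[OF ic[OF jG]] i(2)] by blast
    have comp: "\<phi> i ` ?C = topspace X - \<phi> i ` P"
      using cut_complement[OF ic[OF iG]] by simp
    have "A \<subseteq> T \<Longrightarrow> A \<inter> B = {} \<Longrightarrow> T - D \<subseteq> B \<Longrightarrow> A \<subseteq> D" for A B D T :: "'a set" by blast
    from this[OF cutD(2,6)[OF ic[OF jG]] sub[unfolded comp]]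
    have "\<phi> j ` P \<subseteq> \<phi> i ` P" .
    then have "\<phi> j ` P = \<phi> i ` P" using max i(1) by blast
    moreover have "\<phi> j w \<in> \<phi> i ` P"
      using i(2) cutD(1)[OF ic[OF jG]] unfolding comp by blast
    ultimately show False using cutD(4)[OF ic[OF jG]] by simp
  qed
  moreover have "closedin X N"
  proof -
    have "closedin X (\<Inter>g\<in>carrier G. \<phi> g ` ?C)"
      using clos one_closed by (intro closedin_Inter) auto
    then show ?thesis using clM unfolding N_def by (rule closedin_Int[rotated])
  qed
  moreover have "z \<in> N" if "a \<in> N" "b \<in> N" "between X a z b" for a b z
  proof -
    have "z \<in> M" using that convM[of a b z] by (simp add: N_def)
    moreover have "z \<in> \<phi> g ` ?C" if "g \<in> carrier G" for g
      using between_in_connectedin[OF conn[OF that] ND ND] \<open>a \<in> N\<close> \<open>b \<in> N\<close> \<open>between X a z b\<close> that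
      by metis
    ultimately show ?thesis by (simp add: N_def)
  qed
  moreover have "\<phi> h ` N \<subseteq> N" if h: "h \<in> carrier G" for h
  proof (rule image_subsetI)
    fix x assume x: "x \<in> N"
    have "\<phi> h x \<in> M" using x invM[OF h, of x] by (simp add: N_def)
    moreover have "\<phi> h x \<in> \<phi> g ` ?C" if g: "g \<in> carrier G" for g
    proof -
      have "inv h \<otimes> g \<in> carrier G" using g h by simp
      from ND[OF x this] obtain t where t: "t \<in> ?C" "x = \<phi> (inv h \<otimes> g) t" by (rule imageE)
      have tX: "t \<in> topspace X" using t(1) CX by (rule set_mp[rotated])
      have "\<phi> h x = \<phi> g t"
        using t(2) g h tX element_image[OF g tX refl] by (simp add: composition_rule act_inv')
      then show ?thesis using t(1) by (rule image_eqI)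
    qed
    ultimately show "\<phi> h x \<in> N" by (simp add: N_def)
  qed
  ultimately have "invariant_convex N" unfolding invariant_convex_def by metis
  then have "N = M" using M unfolding minimal_invariant_def by (metis N_def Int_lower1)
  obtain x where x: "x \<in> P" "x \<in> M" using PM by auto
  then have "x \<in> \<phi> \<one> ` ?C" using ND[of x \<one>] \<open>N = M\<close> by simp
  then obtain t where t: "t \<in> ?C" "x = \<phi> \<one> t" by (rule imageE)
  moreover have "\<phi> \<one> t = t"
    using t(1) CX by (metis id_eq_one restrict_apply' subsetD)
  ultimately show False using x(1) C by simp
qed

lemma contracting_neighbourhood_of_end:
  assumes M: "minimal_invariant M" and e: "e \<in> ends M" and F: "finite F" "F \<noteq> {}" "F \<subseteq> M" "e \<notin> F"
  shows "\<exists>w P Q g. w \<in> M \<and> cut X w P Q \<and> e \<in> P \<and> F \<subseteq> Q \<and>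
    g \<in> carrier G \<and> (\<forall>x\<in>topspace X - P. \<phi> g x \<in> P)"
proof -
  have icM: "invariant_convex M" using M by (simp add: minimal_invariant_def)
  then have MX: "M \<subseteq> topspace X" by (simp add: invariant_convex_def closedin_subset)
  have eM: "e \<in> M" and no: "\<And>a b. a \<in> M \<Longrightarrow> b \<in> M \<Longrightarrow> \<not> between X a e b"
    using e by (auto simp: ends_def)
  obtain w P Q where c: "cut X w P Q" "e \<in> P" "F \<subseteq> Q"
    using cut_off_finite[OF F(1,2), of e] F MX eM no by blast
  obtain f where "f \<in> F" using F by blast
  then have "between X e w f" using c by (auto simp: between_def)
  then have w: "w \<in> M" using icM eM F(3) \<open>f \<in> F\<close> unfolding invariant_convex_def by blast
  obtain g where "g \<in> carrier G" "\<forall>x\<in>topspace X - P. \<phi> g x \<in> P"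
    using contracting_element[OF M c(1) w] c(2) eM by blast
  then show ?thesis using w c by blast
qed

lemma ends_invariant:
  assumes M: "invariant_convex M" and e: "e \<in> ends M" and g: "g \<in> carrier G"
  shows "\<phi> g e \<in> ends M"
proof -
  have MX: "M \<subseteq> topspace X" using M by (simp add: invariant_convex_def closedin_subset)
  have inv: "\<phi> h x \<in> M" if "h \<in> carrier G" "x \<in> M" for h x
    using M that unfolding invariant_convex_def by blast
  have eM: "e \<in> M" using e by (simp add: ends_def)
  have "\<not> between X a (\<phi> g e) b" if ab: "a \<in> M" "b \<in> M" for a b
  proof
    assume "between X a (\<phi> g e) b"
    then have "between X (\<phi> (inv g) a) (\<phi> (inv g) (\<phi> g e)) (\<phi> (inv g) b)"
      using homeomorphic_map_between[OF homeo] g by blast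
    then show False
      using e eM MX g ab inv[of "inv g"] act_inv[OF g, of e] by (auto simp: ends_def)
  qed
  then show ?thesis using inv[OF g eM] by (simp add: ends_def)
qed

text \<open>
  The number of ends of a minimal invariant convex set decides. Three ends suffice for ping-pong: the
  neighbourhoods of the second and third end are chosen to cut off the base points of the earlier
  ones, and this makes the three neighbourhoods disjoint.
\<close>

theorem free_subgroup_or_elementary:
  assumes "topspace X \<noteq> {}"
  shows "contains_nonabelian_free_subgroup G \<or> elementary_action G X \<phi>"
proof -
  obtain M where M: "minimal_invariant M" using ex_minimal_invariant[OF assms] .
  then have icM: "invariant_convex M" by (simp add: minimal_invariant_def)
  then have cM: "closedin X M" and MX: "M \<subseteq> topspace X"
    by (simp_all add: invariant_convex_def closedin_subset)
  obtain p where p: "p \<in> M" using icM by (auto simp: invariant_convex_def)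
  show ?thesis
  proof (cases "M = {p}")
    case True
    then have "\<forall>g\<in>carrier G. \<phi> g p = p" using icM by (auto simp: invariant_convex_def)
    then show ?thesis using p MX by (auto simp: elementary_action_def)
  next
    case False
    then obtain a where a: "a \<in> ends M" using ex_end[OF cM p] by blast
    then have aM: "a \<in> M" by (simp add: ends_def)
    then obtain b where b: "b \<in> ends M" "b \<noteq> a" using ex_end[OF cM aM] False p by blast
    then have bM: "b \<in> M" by (simp add: ends_def)
    show ?thesis
    proof (cases "ends M = {a, b}")
      case True
      have "\<phi> g ` {a, b} = {a, b}" if g: "g \<in> carrier G" for g
      proof (rule endo_inj_surj)
        show "\<phi> g ` {a, b} \<subseteq> {a, b}" using ends_invariant[OF icM _ g] True by blast
        show "inj_on (\<phi> g) {a, b}"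
          using inj_prop[OF g] aM bM MX by (meson empty_subsetI inj_on_subset insert_subset subsetD)
      qed simp
      then have "elementary_action G X \<phi>"
        unfolding elementary_action_def using aM bM MX b(2)
        by (intro disjI2 bexI[of _ a] bexI[of _ b] conjI ballI) auto
      then show ?thesis by blast
    next
      case False
      then obtain d where d: "d \<in> ends M" "d \<noteq> a" "d \<noteq> b" using a b by blast
      then have dM: "d \<in> M" by (simp add: ends_def)
      obtain w1 P1 Q1 g1 where 1: "w1 \<in> M" "cut X w1 P1 Q1" "a \<in> P1" "{b, d} \<subseteq> Q1"
          "g1 \<in> carrier G" "\<forall>x\<in>topspace X - P1. \<phi> g1 x \<in> P1"
        using contracting_neighbourhood_of_end[OF M a, of "{b, d}"] b d bM dM by auto
      have "b \<noteq> w1" "d \<noteq> w1" using 1(4) cutD(5)[OF 1(2)] by auto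
      obtain w2 P2 Q2 g2 where 2: "w2 \<in> M" "cut X w2 P2 Q2" "b \<in> P2" "{d, w1} \<subseteq> Q2"
          "g2 \<in> carrier G" "\<forall>x\<in>topspace X - P2. \<phi> g2 x \<in> P2"
        using contracting_neighbourhood_of_end[OF M b(1), of "{d, w1}"] \<open>b \<noteq> w1\<close> d dM 1(1) by auto
      have "d \<noteq> w2" using 2(4) cutD(5)[OF 2(2)] by auto
      obtain w3 P3 Q3 g3 where 3: "w3 \<in> M" "cut X w3 P3 Q3" "d \<in> P3" "{w1, w2} \<subseteq> Q3"
          "g3 \<in> carrier G" "\<forall>x\<in>topspace X - P3. \<phi> g3 x \<in> P3"
        using contracting_neighbourhood_of_end[OF M d(1), of "{w1, w2}"]
          \<open>d \<noteq> w1\<close> \<open>d \<noteq> w2\<close> 1(1) 2(1) by auto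
      (* The closed side of P' avoids w and contains a point of Q, hence lies in Q. *)
      have disjoint: "P \<inter> P' = {}"
        if "cut X w P Q" "cut X w' P' Q'" "w \<in> Q'" "x \<in> P'" "x \<in> Q" for w w' P P' Q Q' x
      proof -
        have "insert w' P' \<subseteq> Q"
          using that cutD(5,6)[OF that(2)]
          by (intro side_subset[OF that(2) cut_sym[OF that(1)]]) auto
        then show ?thesis using cutD(6)[OF that(1)] by blast
      qed
      have "contains_nonabelian_free_subgroup G"
      proof (rule ping_pong_three_players[OF 1(5) 2(5) 3(5)])
        show "P1 \<inter> P2 = {}" using disjoint[OF 1(2) 2(2)] 1(4) 2(3,4) by blast
        show "P2 \<inter> P3 = {}" using disjoint[OF 2(2) 3(2)] 2(4) 3(3,4) by blast
        show "P1 \<inter> P3 = {}" using disjoint[OF 1(2) 3(2)] 1(4) 3(3,4) by blast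
      qed (use 1 2 3 cutD(2)[OF 1(2)] cutD(2)[OF 2(2)] cutD(2)[OF 3(2)] in auto)
      then show ?thesis by blast
    qed
  qed
qed

end


section \<open>Compact locally connected metric spaces are locally path connected\<close>

text \<open>
  The relation \<open>R n\<close> is meant as ``joined by a connected set of diameter at most \<open>e / 2 ^ n\<close>'', and \<open>G n x y\<close> is a
  chain of \<open>k n\<close> links from \<open>x\<close> to \<open>y\<close> whose links are related by \<open>R (Suc n)\<close>. Since the number of links
  depends on \<open>n\<close> only, the \<open>n\<close>-th stage is a sequence \<open>h n\<close> indexed by a uniform grid of \<open>K n\<close> intervals, and
  stage \<open>Suc n\<close> refines the grid. The step functions on these grids converge uniformly, with errors that
  form a geometric series; neighbouring steps are close, so the limit is continuous.
\<close>

lemma limit_of_refined_chains: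
  fixes S :: "'b::complete_space set" and G :: "nat \<Rightarrow> 'b \<Rightarrow> 'b \<Rightarrow> nat \<Rightarrow> 'b"
  assumes S: "closed S"
    and RS: "\<And>n x y. R n x y \<Longrightarrow> x \<in> S \<and> dist x y \<le> e / 2 ^ n \<and> R n y y"
    and k: "\<And>n. 0 < k n"
    and G: "\<And>n x y. R n x y \<Longrightarrow> G n x y 0 = x \<and> G n x y (k n) = y \<and>
        (\<forall>i<k n. R (Suc n) (G n x y i) (G n x y (Suc i))) \<and> (\<forall>i. dist x (G n x y i) \<le> e / 2 ^ n)"
    and ab: "R 0 a b"
  shows "\<exists>f. path f \<and> pathstart f = a \<and> pathfinish f = b \<and> path_image f \<subseteq> S \<inter> cball a (3 * e)"
proof -
  (* The sequence h 0 is a, b, b, ...; so consecutive values are related also beyond the grid. *)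
  define h where "h = rec_nat (\<lambda>i. if i = 0 then a else b)
    (\<lambda>n u i. G n (u (i div k n)) (u (Suc (i div k n))) (i mod k n))"
  have h0: "h 0 i = (if i = 0 then a else b)" for i by (simp add: h_def)
  have hS: "h (Suc n) i = G n (h n (i div k n)) (h n (Suc (i div k n))) (i mod k n)" for n i
    by (simp add: h_def)
  have link: "R n (h n i) (h n (Suc i))" for n i
  proof (induction n arbitrary: i)
    case 0
    show ?case using ab RS by (auto simp: h0)
  next
    case (Suc n)
    let ?q = "i div k n"
    have m: "i mod k n < k n" using k by simp
    have *: "R (Suc n) (G n (h n ?q) (h n (Suc ?q)) (i mod k n))
        (G n (h n ?q) (h n (Suc ?q)) (Suc (i mod k n)))"
      using G[OF Suc.IH] m by blast
    show ?case
    proof (cases "Suc (i mod k n) = k n")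
      case True
      then have "h (Suc n) (Suc i) = G n (h n (Suc ?q)) (h n (Suc (Suc ?q))) 0"
        by (simp add: hS div_Suc mod_Suc)
      also have "\<dots> = G n (h n ?q) (h n (Suc ?q)) (Suc (i mod k n))"
        unfolding True using G[OF Suc.IH] by metis
      finally show ?thesis using * by (simp add: hS)
    next
      case False
      then show ?thesis using * by (simp add: hS div_Suc mod_Suc)
    qed
  qed
  define K where "K n = (\<Prod>j<n. k j)" for n
  have K: "K 0 = 1" "K (Suc n) = K n * k n" "0 < K n" for n
    using k by (simp_all add: K_def prod_pos)
  have h_start: "h n 0 = a" for n
  proof (induction n)
    case (Suc n)
    then show ?case using G[OF link[of n 0]] by (simp add: hS)
  qed (simp add: h0)
  have h_finish: "h n (K n) = b" for n
  proof (induction n)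
    case (Suc n)
    have "h (Suc n) (K (Suc n)) = G n (h n (K n)) (h n (Suc (K n))) 0"
      using k[of n] by (simp add: hS K(2))
    also have "\<dots> = h n (K n)" using G[OF link] by metis
    finally show ?case using Suc by simp
  qed (simp add: h0 K)
  define F where "F n t = h n (nat \<lfloor>t * real (K n)\<rfloor>)" for n t
  have F_step: "dist (F n t) (F (Suc n) t) \<le> e / 2 ^ n" if "0 \<le> t" for n t
  proof -
    let ?i = "nat \<lfloor>t * real (K (Suc n))\<rfloor>"
    have "nat \<lfloor>t * real (K n)\<rfloor> = ?i div k n"
    proof -
      have "t * real (K n) = (t * real (K (Suc n))) / real_of_int (int (k n))"
        using k[of n] by (simp add: K(2))
      then have "\<lfloor>t * real (K n)\<rfloor> = \<lfloor>t * real (K (Suc n))\<rfloor> div int (k n)"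
        by (metis floor_divide_real_eq_div of_nat_0_le_iff)
      then show ?thesis using that by (simp add: nat_div_distrib)
    qed
    then show ?thesis
      using G[OF link[of n "?i div k n"]] by (simp add: F_def hS)
  qed
  have F_tail: "dist (F n t) (F (n + j) t) \<le> 2 * (e / 2 ^ n) - 2 * (e / 2 ^ (n + j))"
    if "0 \<le> t" for n t j
  proof (induction j)
    case (Suc j)
    have "dist (F n t) (F (n + Suc j) t) \<le>
        dist (F n t) (F (n + j) t) + dist (F (n + j) t) (F (Suc (n + j)) t)"
      by (simp add: dist_triangle)
    also have "\<dots> \<le> 2 * (e / 2 ^ n) - 2 * (e / 2 ^ (n + j)) + e / 2 ^ (n + j)"
      using Suc F_step[OF that, of "n + j"] by linarith
    also have "\<dots> = 2 * (e / 2 ^ n) - 2 * (e / 2 ^ (n + Suc j))" by simp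
    finally show ?case .
  qed simp
  have e: "0 \<le> e" using RS[OF ab] order_trans[OF zero_le_dist[of a b]] by auto
  have e0: "(\<lambda>n. c * (e / 2 ^ n)) \<longlonglongrightarrow> 0" for c :: real
    by (intro tendsto_mult_right_zero LIMSEQ_divide_realpow_zero) simp
  have F_close: "dist (F n t) (F m t) \<le> 2 * (e / 2 ^ n)" if "0 \<le> t" "n \<le> m" for n m t
    using F_tail[OF that(1), of n "m - n"] that(2) e by (simp add: order_trans)
  have "Cauchy (\<lambda>n. F n t)" if t: "0 \<le> t" for t
  proof (rule metric_CauchyI)
    fix r :: real assume "0 < r"
    then have "\<forall>\<^sub>F n in sequentially. 4 * (e / 2 ^ n) < r"
      using e0[of 4] by (simp add: order_tendstoD(2))
    then obtain n where n: "4 * (e / 2 ^ n) < r" by (auto simp: eventually_sequentially)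
    have "dist (F m t) (F m' t) < r" if "n \<le> m" "n \<le> m'" for m m'
      using dist_triangle3[of "F m t" "F m' t" "F n t"] F_close[OF t that(1)] F_close[OF t that(2)] n
      by simp
    then show "\<exists>M. \<forall>m\<ge>M. \<forall>n\<ge>M. dist (F m t) (F n t) < r" by blast
  qed
  then have "\<exists>l. (\<lambda>n. F n t) \<longlonglongrightarrow> l" if "0 \<le> t" for t
    using that Cauchy_convergent_iff convergent_def by blast
  then obtain f where f: "\<And>t. 0 \<le> t \<Longrightarrow> (\<lambda>n. F n t) \<longlonglongrightarrow> f t" by metis
  have Ff: "dist (F n t) (f t) \<le> 2 * (e / 2 ^ n)" if "0 \<le> t" for n t
  proof (rule tendsto_upperbound)
    show "(\<lambda>m. dist (F n t) (F m t)) \<longlonglongrightarrow> dist (F n t) (f t)"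
      by (intro tendsto_intros f that)
    show "\<forall>\<^sub>F m in sequentially. dist (F n t) (F m t) \<le> 2 * (e / 2 ^ n)"
      using F_close[OF that] by (auto simp: eventually_sequentially)
  qed simp
  have step: "dist (f s) (f t) \<le> 5 * (e / 2 ^ n)"
    if st: "0 \<le> s" "s \<le> t" "t - s < 1 / real (K n)" for s t n
  proof -
    have "t * real (K n) < s * real (K n) + 1"
      using st(3) K(3)[of n] by (simp add: field_simps)
    moreover have "s * real (K n) \<le> t * real (K n)" using st(2) by (simp add: mult_right_mono)
    ultimately have "\<lfloor>t * real (K n)\<rfloor> = \<lfloor>s * real (K n)\<rfloor> \<or>
        \<lfloor>t * real (K n)\<rfloor> = \<lfloor>s * real (K n)\<rfloor> + 1"
      by linarith
    then have "nat \<lfloor>t * real (K n)\<rfloor> = nat \<lfloor>s * real (K n)\<rfloor> \<or>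
        nat \<lfloor>t * real (K n)\<rfloor> = Suc (nat \<lfloor>s * real (K n)\<rfloor>)"
      using st(1) by (auto simp: Suc_nat_eq_nat_zadd1)
    then have "dist (F n s) (F n t) \<le> e / 2 ^ n"
      using RS[OF link[of n "nat \<lfloor>s * real (K n)\<rfloor>"]] e by (auto simp: F_def)
    moreover have "dist (f s) (f t) \<le> dist (F n s) (f s) + dist (F n s) (F n t) + dist (F n t) (f t)"
      using dist_triangle[of "f s" "f t" "F n s"] dist_triangle[of "F n s" "f t" "F n t"]
      by (simp add: dist_commute[of "f s"])
    ultimately show ?thesis using Ff[of s n] Ff[of t n] st by linarith
  qed
  have "path f"
    unfolding path_def continuous_on_iff
  proof (intro ballI allI impI)
    fix s r :: real assume s: "s \<in> {0..1}" and "0 < r"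
    then have "\<forall>\<^sub>F n in sequentially. 5 * (e / 2 ^ n) < r"
      using e0[of 5] by (simp add: order_tendstoD(2))
    then obtain n where n: "5 * (e / 2 ^ n) < r" by (auto simp: eventually_sequentially)
    have "dist (f t) (f s) < r" if t: "t \<in> {0..1}" "dist t s < 1 / real (K n)" for t
    proof (cases "s \<le> t")
      case True
      then show ?thesis using step[of s t n] s t n by (simp add: dist_real_def dist_commute)
    next
      case False
      then show ?thesis using step[of t s n] s t n by (simp add: dist_real_def)
    qed
    then show "\<exists>d>0. \<forall>t\<in>{0..1}. dist t s < d \<longrightarrow> dist (f t) (f s) < r"
      using K(3)[of n] by (intro exI[of _ "1 / real (K n)"]) auto
  qed
  moreover have "f 0 = a"
    using f[of 0] h_start by (simp add: F_def LIMSEQ_const_iff)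
  moreover have "f 1 = b"
    using f[of 1] h_finish by (simp add: F_def LIMSEQ_const_iff)
  moreover have "f t \<in> S \<inter> cball a (3 * e)" if t: "t \<in> {0..1}" for t
  proof
    show "f t \<in> S"
      using closed_sequentially[OF S _ f[of t]] RS[OF link] t by (simp add: F_def)
    have "dist a (F 0 t) \<le> e" using RS[OF ab] e by (auto simp: F_def h0)
    then have "dist a (f t) \<le> 3 * e"
      using Ff[of t 0] t dist_triangle[of a "f t" "F 0 t"] by simp
    then show "f t \<in> cball a (3 * e)" by simp
  qed
  ultimately show ?thesis
    by (intro exI[of _ f]) (auto simp: pathstart_def pathfinish_def path_image_def)
qed

text \<open>
  Two members of the cover are adjacent if they meet inside \<open>C\<close>. As \<open>C\<close> is connected, the members reachable
  from one that contains \<open>x\<close> cover \<open>C\<close>. What matters is that the length of the chain is bounded by the size of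
  the cover, independently of \<open>C\<close>, \<open>x\<close> and \<open>y\<close>; shorter chains are padded with \<open>y\<close>.
\<close>

lemma connected_finite_cover_chain:
  assumes fin: "finite \<W>" and op: "\<And>W. W \<in> \<W> \<Longrightarrow> openin X W"
    and C: "connectedin X C" "C \<subseteq> \<Union>\<W>" and xy: "x \<in> C" "y \<in> C"
  shows "\<exists>g. g 0 = x \<and> g (Suc (card (\<W> \<times> \<W>))) = y \<and>
    (\<forall>i. \<exists>W\<in>\<W>. g i \<in> W \<and> g (Suc i) \<in> W) \<and> (\<forall>i. g i \<in> C)"
proof -
  define E where "E = {(V, W) \<in> \<W> \<times> \<W>. V \<inter> W \<inter> C \<noteq> {}}"
  have "E \<subseteq> \<W> \<times> \<W>" by (auto simp: E_def)
  then have E: "finite E" "card E \<le> card (\<W> \<times> \<W>)"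
    using fin by (meson card_mono finite_SigmaI finite_subset)+
  obtain V where V: "V \<in> \<W>" "x \<in> V" using C(2) xy(1) by blast
  define Q where "Q = E\<^sup>* `` {V}"
  have Q: "Q \<subseteq> \<W>"
  proof
    fix W assume "W \<in> Q"
    then have "(V, W) \<in> E\<^sup>*" by (simp add: Q_def)
    then show "W \<in> \<W>" by (induction rule: rtrancl_induct) (use V E_def in auto)
  qed
  have "\<exists>W\<in>Q. y \<in> W"
  proof (rule ccontr)
    assume n: "\<not> ?thesis"
    have "openin X (\<Union>Q)" "openin X (\<Union>(\<W> - Q))" using op Q by (auto intro!: openin_Union)
    moreover have "C \<subseteq> \<Union>Q \<union> \<Union>(\<W> - Q)" using C(2) by blast
    moreover have "\<Union>Q \<inter> \<Union>(\<W> - Q) \<inter> C = {}"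
    proof (rule ccontr)
      assume "\<not> ?thesis"
      then obtain A B p where "A \<in> Q" "B \<in> \<W>" "B \<notin> Q" "p \<in> A" "p \<in> B" "p \<in> C" by blast
      moreover from this have "(A, B) \<in> E" using Q by (auto simp: E_def)
      ultimately show False by (auto simp: Q_def intro: rtrancl_into_rtrancl)
    qed
    moreover have "\<Union>Q \<inter> C \<noteq> {}" using V xy(1) by (auto simp: Q_def)
    moreover have "\<Union>(\<W> - Q) \<inter> C \<noteq> {}" using n xy(2) C(2) by blast
    ultimately show False using C(1) unfolding connectedin by blast
  qed
  then obtain W where W: "y \<in> W" "(V, W) \<in> E\<^sup>*" by (auto simp: Q_def)
  then obtain n where n: "n \<le> card E" "(V, W) \<in> E ^^ n"
    unfolding rtrancl_finite_eq_relpow[OF E(1)] by blast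
  then obtain u where u: "u 0 = V" "u n = W" "\<And>i. i < n \<Longrightarrow> (u i, u (Suc i)) \<in> E"
    unfolding relpow_fun_conv by blast
  have "\<forall>i. \<exists>p. i < n \<longrightarrow> p \<in> u i \<and> p \<in> u (Suc i) \<and> p \<in> C"
    using u(3) unfolding E_def by blast
  then obtain p where p: "\<And>i. i < n \<Longrightarrow> p i \<in> u i \<and> p i \<in> u (Suc i) \<and> p i \<in> C" by metis
  have u\<W>: "u i \<in> \<W>" if "i \<le> n" for i
    using that u(1,3) V(1) unfolding E_def by (cases i) auto
  define g where "g i = (if i = 0 then x else if i \<le> n then p (i - 1) else y)" for i
  have "g i \<in> u (min i n) \<and> g (Suc i) \<in> u (min i n)" for i
  proof (cases "i < n")
    case True
    then show ?thesis using V u(1) p[of i] p[of "i - 1"] by (auto simp: g_def)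
  next
    case False
    then have "min i n = n" by simp
    then show ?thesis
      using False W(1) V u(1,2) p[of "i - 1"] by (cases "i = n"; cases i) (auto simp: g_def)
  qed
  then have "\<forall>i. \<exists>W\<in>\<W>. g i \<in> W \<and> g (Suc i) \<in> W" using u\<W> by (meson min.cobounded2)
  moreover have "g i \<in> C" for i using p[of "i - 1"] xy by (auto simp: g_def)
  ultimately show ?thesis
    using n(1) E(2) by (intro exI[of _ g]) (auto simp: g_def)
qed

definition linked :: "'b::metric_space set \<Rightarrow> real \<Rightarrow> 'b \<Rightarrow> 'b \<Rightarrow> bool" where
  "linked S e x y \<longleftrightarrow> (\<exists>C. connected C \<and> C \<subseteq> S \<and> x \<in> C \<and> y \<in> C \<and> (\<forall>u\<in>C. \<forall>v\<in>C. dist u v \<le> e))"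

lemma locally_connected_small_neighbourhood:
  fixes S :: "'b::metric_space set"
  assumes "locally_connected_space (top_of_set S)" "x \<in> S" "0 < e"
  obtains U where "openin (top_of_set S) U" "connected U" "x \<in> U" "\<And>u v. u \<in> U \<Longrightarrow> v \<in> U \<Longrightarrow> dist u v \<le> e"
proof -
  have "openin (top_of_set S) (S \<inter> ball x (e / 2))" "x \<in> S \<inter> ball x (e / 2)"
    using assms by (auto intro: openin_open_Int)
  then obtain U where U: "openin (top_of_set S) U" "connectedin (top_of_set S) U" "x \<in> U"
      "U \<subseteq> S \<inter> ball x (e / 2)"
    using assms(1) unfolding locally_connected_space by blast
  have "dist u v \<le> e" if "u \<in> U" "v \<in> U" for u v
  proof -
    have "dist x u < e / 2" "dist x v < e / 2" using U(4) that by auto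
    then show ?thesis using dist_triangle3[of u v x] by linarith
  qed
  then show thesis using that U by (simp add: connectedin_subtopology)
qed

text \<open>
  The number \<open>N\<close> comes from one finite cover by connected sets of diameter at most \<open>e\<close>, and so it serves all
  linked pairs at once; the uniform grids in the limit construction require this.
\<close>

lemma linked_refinement:
  fixes S :: "'b::metric_space set"
  assumes S: "compact S" "locally_connected_space (top_of_set S)" and "0 < e"
  shows "\<exists>N>0. \<forall>d x y. linked S d x y \<longrightarrow> (\<exists>g. g 0 = x \<and> g N = y \<and>
    (\<forall>i<N. linked S e (g i) (g (Suc i))) \<and> (\<forall>i. dist x (g i) \<le> d))"
proof -
  have "\<forall>x\<in>S. \<exists>U. openin (top_of_set S) U \<and> connected U \<and> x \<in> U \<and> (\<forall>u\<in>U. \<forall>v\<in>U. dist u v \<le> e)"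
    using locally_connected_small_neighbourhood[OF S(2) _ \<open>0 < e\<close>] by metis
  then obtain U where U: "\<And>x. x \<in> S \<Longrightarrow> openin (top_of_set S) (U x) \<and> connected (U x) \<and> x \<in> U x \<and>
      (\<forall>u\<in>U x. \<forall>v\<in>U x. dist u v \<le> e)" by metis
  have "S \<subseteq> \<Union>(U ` S)" "\<forall>c\<in>U ` S. openin (top_of_set S) c" using U by auto
  then obtain \<W> where \<W>: "\<W> \<subseteq> U ` S" "finite \<W>" "S \<subseteq> \<Union>\<W>"
    using S(1) unfolding compact_eq_openin_cover by meson
  have op: "openin (top_of_set S) W" if "W \<in> \<W>" for W using \<W>(1) U that by auto
  have small: "linked S e x y" if W: "x \<in> W" "y \<in> W" "W \<in> \<W>" for x y W
  proof -
    have "connected W \<and> (\<forall>u\<in>W. \<forall>v\<in>W. dist u v \<le> e)" using W(3) \<W>(1) U by auto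
    then show ?thesis
      using W openin_imp_subset[OF op[OF W(3)]] unfolding linked_def by (intro exI[of _ W]) auto
  qed
  let ?N = "Suc (card (\<W> \<times> \<W>))"
  have "\<exists>g. g 0 = x \<and> g ?N = y \<and> (\<forall>i<?N. linked S e (g i) (g (Suc i))) \<and> (\<forall>i. dist x (g i) \<le> d)"
    if xy: "linked S d x y" for d x y
  proof -
    obtain C where C: "connected C" "C \<subseteq> S" "x \<in> C" "y \<in> C" "\<forall>u\<in>C. \<forall>v\<in>C. dist u v \<le> d"
      using xy unfolding linked_def by blast
    have "connectedin (top_of_set S) C" using C by (simp add: connectedin_subtopology)
    from connected_finite_cover_chain[OF \<W>(2) op this order_trans[OF C(2) \<W>(3)] C(3,4)]
    obtain g where g: "g 0 = x" "g ?N = y" "\<forall>i. \<exists>W\<in>\<W>. g i \<in> W \<and> g (Suc i) \<in> W" "\<forall>i. g i \<in> C"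
      by blast
    have "\<forall>i<?N. linked S e (g i) (g (Suc i))" using g(3) small by blast
    moreover have "\<forall>i. dist x (g i) \<le> d" using g(4) C(3,5) by blast
    ultimately show ?thesis using g(1,2) by blast
  qed
  then show ?thesis by blast
qed

lemma linked_imp_path:
  fixes S :: "'b::complete_space set"
  assumes S: "compact S" "locally_connected_space (top_of_set S)" and "0 < e" and ab: "linked S e a b"
  shows "\<exists>f. path f \<and> pathstart f = a \<and> pathfinish f = b \<and> path_image f \<subseteq> S \<inter> cball a (3 * e)"
proof -
  have "\<forall>n. \<exists>N>0. \<forall>x y. linked S (e / 2 ^ n) x y \<longrightarrow> (\<exists>g. g 0 = x \<and> g N = y \<and>
    (\<forall>i<N. linked S (e / 2 ^ Suc n) (g i) (g (Suc i))) \<and> (\<forall>i. dist x (g i) \<le> e / 2 ^ n))"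
  proof
    fix n
    have "0 < e / 2 ^ Suc n" using \<open>0 < e\<close> by simp
    from linked_refinement[OF S this]
    show "\<exists>N>0. \<forall>x y. linked S (e / 2 ^ n) x y \<longrightarrow> (\<exists>g. g 0 = x \<and> g N = y \<and>
        (\<forall>i<N. linked S (e / 2 ^ Suc n) (g i) (g (Suc i))) \<and> (\<forall>i. dist x (g i) \<le> e / 2 ^ n))"
      by meson
  qed
  then obtain k where k: "\<And>n. 0 < k n"
    and g: "\<And>n x y. linked S (e / 2 ^ n) x y \<Longrightarrow> \<exists>g. g 0 = x \<and> g (k n) = y \<and>
      (\<forall>i<k n. linked S (e / 2 ^ Suc n) (g i) (g (Suc i))) \<and> (\<forall>i. dist x (g i) \<le> e / 2 ^ n)"
    by metis
  define G where "G n x y = (SOME g. g 0 = x \<and> g (k n) = y \<and>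
    (\<forall>i<k n. linked S (e / 2 ^ Suc n) (g i) (g (Suc i))) \<and> (\<forall>i. dist x (g i) \<le> e / 2 ^ n))" for n x y
  show ?thesis
  proof (rule limit_of_refined_chains[where R = "\<lambda>n. linked S (e / 2 ^ n)" and G = G, OF _ _ k])
    show "closed S" using S(1) by (rule compact_imp_closed)
    show "G n x y 0 = x \<and> G n x y (k n) = y \<and>
        (\<forall>i<k n. linked S (e / 2 ^ Suc n) (G n x y i) (G n x y (Suc i))) \<and> (\<forall>i. dist x (G n x y i) \<le> e / 2 ^ n)"
      if "linked S (e / 2 ^ n) x y" for n x y
      unfolding G_def by (rule someI_ex[OF g[OF that]])
    show "x \<in> S \<and> dist x y \<le> e / 2 ^ n \<and> linked S (e / 2 ^ n) y y"
      if "linked S (e / 2 ^ n) x y" for n x y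
      using that unfolding linked_def by blast
    show "linked S (e / 2 ^ 0) a b" using ab by simp
  qed
qed

text \<open>
  The compact case of the theorem of Mazurkiewicz, Moore and Menger: nearby points are linked by a small
  connected set, hence by chains of ever smaller connected sets, whose limit is a path that stays
  nearby.
\<close>

theorem locally_connected_imp_locally_path_connected:
  fixes S :: "'b::complete_space set"
  assumes S: "compact S" "locally_connected_space (top_of_set S)"
  shows "locally path_connected S"
  unfolding locally_path_connected_im_kleinen
proof (intro allI impI)
  fix V x assume V: "openin (top_of_set S) V \<and> x \<in> V"
  then have xS: "x \<in> S" using openin_imp_subset by blast
  obtain r where r: "0 < r" "S \<inter> cball x r \<subseteq> V"
    using V unfolding openin_contains_cball by (auto simp: Int_commute)
  have "0 < r / 3" using r by simp
  then obtain U where U: "openin (top_of_set S) U" "connected U" "x \<in> U"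
      "\<And>u v. u \<in> U \<Longrightarrow> v \<in> U \<Longrightarrow> dist u v \<le> r / 3"
    using locally_connected_small_neighbourhood[OF S(2) xS] by metis
  have US: "U \<subseteq> S" using U(1) openin_imp_subset by blast
  have "\<exists>p. path p \<and> path_image p \<subseteq> V \<and> pathstart p = x \<and> pathfinish p = y" if "y \<in> U" for y
  proof -
    have "linked S (r / 3) x y" using U US that unfolding linked_def by blast
    from linked_imp_path[OF S \<open>0 < r / 3\<close> this] show ?thesis using r(2) by auto
  qed
  moreover have "U \<subseteq> V"
  proof
    fix y assume "y \<in> U"
    then have "dist x y \<le> r" using U(4)[OF U(3), of y] r(1) by simp
    then show "y \<in> V" using r(2) US \<open>y \<in> U\<close> by auto
  qed
  ultimately show "\<exists>u. openin (top_of_set S) u \<and> x \<in> u \<and> u \<subseteq> V \<and>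
      (\<forall>y. y \<in> u \<longrightarrow> (\<exists>p. path p \<and> path_image p \<subseteq> V \<and> pathstart p = x \<and> pathfinish p = y))"
    using U(1,3) by blast
qed


section \<open>Dendrites are dendrons\<close>

text \<open>
  Let \<open>s\<close> and \<open>t\<close> be the last time before \<open>c\<close> and the first time after \<open>c\<close> at which \<open>p\<close> meets \<open>q\<close>. The part of \<open>p\<close>
  between them meets \<open>q\<close> only in its end points, and the part of \<open>q\<close> between these two points closes it to
  a simple loop.
\<close>

lemma arc_detour_simple_loop:
  fixes p q :: "real \<Rightarrow> 'b::real_normed_vector"
  assumes p: "arc p" and q: "arc q" and ends: "pathstart q = pathstart p" "pathfinish q = pathfinish p"
    and c: "c \<in> {0..1}" "p c \<notin> path_image q"
  shows "\<exists>g. simple_path g \<and> pathfinish g = pathstart g \<and> path_image g \<subseteq> path_image p \<union> path_image q"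
proof -
  define T where "T = {t \<in> {0..1}. p t \<in> path_image q}"
  have "continuous_on {0..1} p" using p arc_imp_path path_def by blast
  moreover have "closed (path_image q)" by (simp add: q arc_imp_path closed_path_image)
  ultimately have "closed T"
    unfolding T_def using continuous_closed_preimage[of "{0..1}" p "path_image q"]
    by (simp add: vimage_def Int_def)
  have T0: "0 \<in> T" "1 \<in> T"
    using ends pathstart_in_path_image[of q] pathfinish_in_path_image[of q]
    by (auto simp: T_def pathstart_def pathfinish_def)
  have cT: "c \<notin> T" using c by (simp add: T_def)
  have "compact (T \<inter> {0..c})" "T \<inter> {0..c} \<noteq> {}"
    using \<open>closed T\<close> T0 c by (auto intro: closed_Int_compact)
  from compact_attains_sup[OF this] obtain s where
    "s \<in> T \<inter> {0..c}" and s_max: "\<forall>t\<in>T \<inter> {0..c}. t \<le> s" by blast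
  then have s: "s \<in> T" "s \<le> c" by auto
  have "compact (T \<inter> {c..1})" "T \<inter> {c..1} \<noteq> {}"
    using \<open>closed T\<close> T0 c by (auto intro: closed_Int_compact)
  from compact_attains_inf[OF this] obtain t where
    "t \<in> T \<inter> {c..1}" and t_min: "\<forall>r\<in>T \<inter> {c..1}. t \<le> r" by blast
  then have t: "t \<in> T" "c \<le> t" by auto
  have sc: "s < c" "c < t" using s t cT by (metis order_le_less)+
  have s01: "s \<in> {0..1}" and t01: "t \<in> {0..1}" using s t by (auto simp: T_def)
  obtain u where u: "u \<in> {0..1}" "q u = p s" using s(1) by (auto simp: T_def path_image_def)
  obtain v where v: "v \<in> {0..1}" "q v = p t" using t(1) by (auto simp: T_def path_image_def)
  have "p s \<noteq> p t" using p s01 t01 sc unfolding arc_def inj_on_def by (metis less_irrefl order_less_trans)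
  then have "v \<noteq> u" using u v by auto
  let ?p = "subpath s t p" and ?q = "subpath v u q"
  have "simple_path (?p +++ ?q)"
  proof (rule simple_path_join_loop)
    show "arc ?p" using arc_subpath_arc[OF p s01 t01] sc by simp
    show "arc ?q" using arc_subpath_arc[OF q v(1) u(1) \<open>v \<noteq> u\<close>] .
    show "path_image ?p \<inter> path_image ?q \<subseteq> {pathstart ?p, pathstart ?q}"
    proof
      fix y assume y: "y \<in> path_image ?p \<inter> path_image ?q"
      then obtain r where r: "s \<le> r" "r \<le> t" "y = p r" using sc by (auto simp: path_image_subpath)
      have "y \<in> path_image q" using y path_image_subpath_subset[OF v(1) u(1)] by blast
      then have "r \<in> T" using r s01 t01 by (simp add: T_def)
      then have "r \<le> c \<longrightarrow> r \<le> s" "c \<le> r \<longrightarrow> t \<le> r"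
        using s_max t_min r(1,2) s01 t01 by auto
      then have "r = s \<or> r = t" using r(1,2) by linarith
      then show "y \<in> {pathstart ?p, pathstart ?q}" using r v by auto
    qed
  qed (use u v in auto)
  moreover have "path_image (?p +++ ?q) \<subseteq> path_image p \<union> path_image q"
    using path_image_join_subset[of ?p ?q] path_image_subpath_subset[OF s01 t01, of p]
      path_image_subpath_subset[OF v(1) u(1), of q] by blast
  ultimately show ?thesis using u by (intro exI[of _ "?p +++ ?q"]) auto
qed

text \<open>
  Take an arc from \<open>a\<close> to \<open>b\<close> and an interior point \<open>c\<close> of it. As \<open>c\<close> does not separate \<open>a\<close> from \<open>b\<close>, both lie in
  one path component of the complement of \<open>c\<close>, and so a second arc joins them and avoids \<open>c\<close>.
\<close>

lemma not_between_imp_simple_loop: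
  fixes S :: "'b::{complete_space, real_normed_vector} set"
  assumes S: "connected S" "locally path_connected S"
    and ab: "a \<in> S" "b \<in> S" "a \<noteq> b" and n: "\<nexists>z. between (top_of_set S) a z b"
  shows "\<exists>g. simple_path g \<and> pathfinish g = pathstart g \<and> path_image g \<subseteq> S"
proof -
  have arc: "\<exists>p. arc p \<and> path_image p \<subseteq> T \<and> pathstart p = a \<and> pathfinish p = b"
    if pc: "path_component T a b" for T
  proof -
    obtain f where "path f" "path_image f \<subseteq> T" "pathstart f = a" "pathfinish f = b"
      using pc unfolding path_component_def by blast
    then obtain p where "arc p" "path_image p \<subseteq> path_image f" "pathstart p = a" "pathfinish p = b"
      using path_contains_arc[of f a b] ab(3) by blast
    then show ?thesis using \<open>path_image f \<subseteq> T\<close> by blast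
  qed
  have "connected_component S a b"
    using S(1) ab unfolding connected_component_def by blast
  then obtain p where p: "arc p" "path_image p \<subseteq> S" "pathstart p = a" "pathfinish p = b"
    using arc[of S] S(2) by (auto simp: path_component_eq_connected_component)
  define c where "c = p (1 / 2)"
  have inj: "inj_on p {0..1}" using p(1) by (simp add: arc_def)
  have "c \<noteq> p 0" "c \<noteq> p 1"
    using inj_on_eq_iff[OF inj, of "1/2" 0] inj_on_eq_iff[OF inj, of "1/2" 1] by (auto simp: c_def)
  then have ca: "c \<noteq> a" "c \<noteq> b" using p by (auto simp: pathstart_def pathfinish_def)
  have cS: "c \<in> S" using p(2) by (auto simp: c_def path_image_def)
  let ?T = "S - {c}"
  have opT: "openin (top_of_set S) ?T" by (simp add: openin_delete)
  have lpT: "locally path_connected ?T" using locally_open_subset[OF S(2) opT] .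
  have "path_component ?T a b"
  proof (rule ccontr)
    assume nb: "\<not> path_component ?T a b"
    let ?A = "path_component_set ?T a"
    have "openin (top_of_set S) ?A"
      using openin_trans[OF openin_path_component_locally_path_connected[OF lpT] opT] .
    moreover have "openin (top_of_set ?T) (?T - ?A)"
      using closedin_path_component_locally_path_connected[OF lpT] by (metis openin_diff openin_subtopology_self)
    then have "openin (top_of_set S) (?T - ?A)" using openin_trans opT by blast
    moreover have "?A \<subseteq> ?T" by (simp add: path_component_subset)
    ultimately have "cut (top_of_set S) c ?A (?T - ?A)" using cS by (auto simp: cut_def)
    moreover have "a \<in> ?A" using ab ca by (simp add: path_component_refl_eq)
    moreover have "b \<in> ?T - ?A" using ab ca nb by simp
    ultimately show False using n unfolding between_def by blast
  qed
  then obtain q where q: "arc q" "path_image q \<subseteq> ?T" "pathstart q = a" "pathfinish q = b"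
    using arc[of ?T] by blast
  then have "p (1 / 2) \<notin> path_image q" by (auto simp: c_def)
  then show ?thesis
    using arc_detour_simple_loop[OF p(1) q(1), of "1 / 2"] p q by fastforce
qed

text \<open>
  The Kuratowski embedding of a metric space into a Banach space, with the distance capped at \<open>1\<close> to make
  the functions bounded.
\<close>

definition capped_distance :: "'c::metric_space \<Rightarrow> 'c \<Rightarrow>\<^sub>C real" where
  "capped_distance u = Bcontfun (\<lambda>v. min 1 (dist u v))"

lemma apply_capped_distance: "apply_bcontfun (capped_distance u) v = min 1 (dist u v)"
proof -
  have "(\<lambda>v. min 1 (dist u v)) \<in> bcontfun"
    by (auto simp: bcontfun_def bounded_iff intro!: continuous_intros exI[of _ 1])
  then show ?thesis by (simp add: capped_distance_def Bcontfun_inverse)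
qed

lemma inj_capped_distance: "inj capped_distance"
proof (rule injI)
  fix u v :: "'c::metric_space" assume "capped_distance u = capped_distance v"
  then have "min 1 (dist u v) = min 1 (dist v v)" by (metis apply_capped_distance)
  then show "u = v" by (simp add: min_def split: if_splits)
qed

lemma continuous_on_capped_distance:
  fixes A :: "'c::metric_space set"
  shows "continuous_on A capped_distance"
proof (rule continuous_onI)
  fix u :: 'c and r :: real assume r: "0 < r"
  have "dist (capped_distance v) (capped_distance u) \<le> dist v u" for v u :: 'c
  proof (rule dist_bound)
    fix w
    have "dist v w \<le> dist v u + dist u w" "dist u w \<le> dist v u + dist v w"
      by (rule dist_triangle dist_triangle3)+
    then show "dist (apply_bcontfun (capped_distance v) w) (apply_bcontfun (capped_distance u) w) \<le> dist v u"
      by (auto simp: apply_capped_distance dist_real_def min_def)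
  qed
  then show "\<exists>d>0. \<forall>v\<in>A. dist v u < d \<longrightarrow> dist (capped_distance v) (capped_distance u) \<le> r"
    using r by (intro exI[of _ r]) (meson less_imp_le order_trans)
qed

text \<open>
  The arcs of the preceding lemmas live in a Banach space, so the space has to be moved into one.
  The distances to a countable dense set map it injectively and continuously to \<open>nat \<Rightarrow> real\<close>, a metric
  space, and the Kuratowski embedding of the latter does the rest.
\<close>

lemma compact_metrizable_embedding:
  assumes "compact_space X" "metrizable_space X"
  shows "\<exists>f :: 'a \<Rightarrow> ((nat \<Rightarrow> real) \<Rightarrow>\<^sub>C real). homeomorphic_map X (top_of_set (f ` topspace X)) f"
proof -
  obtain M d where M: "Metric_space M d" and X: "X = Metric_space.mtopology M d"
    using assms(2) unfolding metrizable_space_def by blast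
  interpret Metric_space M d by (rule M)
  have top: "topspace X = M" using X by simp
  then have "compactin mtopology M" using assms(1) X by (simp add: compact_space_def)
  then have "mtotally_bounded M" by (rule compactin_imp_mtotally_bounded)
  then have "\<forall>n. \<exists>K. finite K \<and> K \<subseteq> M \<and> M \<subseteq> (\<Union>x\<in>K. mball x (1 / real (Suc n)))"
    unfolding mtotally_bounded_def by simp
  then obtain K where K: "\<And>n. finite (K n)" "\<And>n. K n \<subseteq> M"
      "\<And>n. M \<subseteq> (\<Union>x\<in>K n. mball x (1 / real (Suc n)))"
    by metis
  define D where "D = (\<Union>n. K n)"
  have "countable D" unfolding D_def using K(1) by (simp add: countable_finite)
  moreover have "D \<subseteq> M" unfolding D_def using K(2) by blast
  ultimately have D: "countable D" "D \<subseteq> M" by auto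
  define e where "e x n = d x (from_nat_into D n)" for x n
  have dense: "\<exists>n. e x n < r \<and> from_nat_into D n \<in> M" if "x \<in> M" "0 < r" for x r
  proof -
    obtain k where k: "1 / real (Suc k) < r" using \<open>0 < r\<close> nat_approx_posE by blast
    obtain y where "y \<in> K k" "x \<in> mball y (1 / real (Suc k))" using K(3)[of k] \<open>x \<in> M\<close> by blast
    then have y: "d x y < r" "y \<in> D" using k by (auto simp: D_def commute)
    then obtain n where "from_nat_into D n = y" using from_nat_into_surj[OF D(1)] by blast
    then show ?thesis using y D(2) by (auto simp: e_def)
  qed
  have "inj_on e M"
  proof (rule inj_onI, rule ccontr)
    fix x y assume xy: "x \<in> M" "y \<in> M" "e x = e y" "x \<noteq> y"
    then have "0 < d x y / 2" by simp
    then obtain n where n: "e x n < d x y / 2" "from_nat_into D n \<in> M" using dense[OF xy(1)] by blast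
    have "d x y \<le> e x n + e y n"
      using triangle[OF xy(1) n(2) xy(2)] commute by (simp add: e_def)
    then show False using n(1) xy(3) by simp
  qed
  have "continuous_map X euclidean (\<lambda>x. e x n)" for n
  proof (cases "D = {}")
    case True
    then have "M = {}" using K(3)[of 0] unfolding D_def by auto
    then show ?thesis using top by (simp add: continuous_map_def)
  next
    case False
    then have "from_nat_into D n \<in> M" using D(2) from_nat_into[of D n] by blast
    then show ?thesis
      unfolding e_def X
      using continuous_map_mdist[of mtopology Self "\<lambda>x. x" "\<lambda>x. from_nat_into D n"]
      by (simp add: mtopology_of_def)
  qed
  then have "continuous_map X euclidean e"
    using continuous_map_componentwise_UNIV[of X "\<lambda>_. euclideanreal" e]
    by (simp add: euclidean_product_topology)
  then have "continuous_map X euclidean (capped_distance \<circ> e)"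
    by (rule continuous_map_compose) (simp add: continuous_on_capped_distance)
  then have cont: "continuous_map X (top_of_set ((capped_distance \<circ> e) ` M)) (capped_distance \<circ> e)"
    by (simp add: continuous_map_in_subtopology top)
  have "homeomorphic_map X (top_of_set ((capped_distance \<circ> e) ` M)) (capped_distance \<circ> e)"
  proof (rule bijective_closed_imp_homeomorphic_map[OF cont])
    show "closed_map X (top_of_set ((capped_distance \<circ> e) ` M)) (capped_distance \<circ> e)"
      using assms(1) cont by (intro continuous_imp_closed_map_gen Hausdorff_imp_kc_space)
        (simp_all add: Hausdorff_space_subtopology)
    show "inj_on (capped_distance \<circ> e) (topspace X)"
      using \<open>inj_on e M\<close> inj_on_subset[OF inj_capped_distance] top by (intro comp_inj_on) auto
  qed (use top in auto)
  then show ?thesis using top by blast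
qed

text \<open>
  Both betweenness and simple closed curves are carried over by homeomorphisms, so the question is settled
  in the Banach space.
\<close>

lemma dendrite_imp_dendron:
  assumes "dendrite X"
  shows "dendron X"
proof
  show comp: "compact_space X" and conn: "connected_space X"
    using assms by (auto simp: dendrite_def continuum_space_def)
  have metr: "metrizable_space X" and lc: "locally_connected_space X"
    and nc: "\<nexists>C. simple_closed_curve_in X C"
    using assms by (auto simp: dendrite_def continuum_space_def)
  obtain f :: "'a \<Rightarrow> ((nat \<Rightarrow> real) \<Rightarrow>\<^sub>C real)" where f: "homeomorphic_map X (top_of_set (f ` topspace X)) f"
    using compact_metrizable_embedding[OF comp metr] by blast
  let ?S = "f ` topspace X"
  have hs: "X homeomorphic_space top_of_set ?S" using f homeomorphic_map_imp_homeomorphic_space by blast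
  have "compact ?S" using comp homeomorphic_compact_space[OF hs]
    by (simp add: compact_space_def[of "top_of_set _"] compactin_subtopology)
  moreover have lcS: "locally_connected_space (top_of_set ?S)"
    using lc homeomorphic_locally_connected_space[OF hs] by simp
  ultimately have lpc: "locally path_connected ?S" by (rule locally_connected_imp_locally_path_connected)
  have connS: "connected ?S"
    using conn homeomorphic_connected_space[OF hs] by (simp add: connectedin_subtopology flip: connectedin_topspace)
  obtain f' where f': "homeomorphic_maps X (top_of_set ?S) f f'" using f homeomorphic_map_maps by blast
  then have hf': "homeomorphic_map (top_of_set ?S) X f'" 
    using homeomorphic_maps_map by blast
  have f'f: "f' (f x) = x" if "x \<in> topspace X" for x
    using f' that by (simp add: homeomorphic_maps_def)
  fix a b assume ab: "a \<in> topspace X" "b \<in> topspace X" "a \<noteq> b"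
  show "\<exists>z. between X a z b"
  proof (rule ccontr)
    assume n: "\<nexists>z. between X a z b"
    have "\<nexists>z. between (top_of_set ?S) (f a) z (f b)"
    proof
      assume "\<exists>z. between (top_of_set ?S) (f a) z (f b)"
      then obtain z where "between (top_of_set ?S) (f a) z (f b)" by blast
      from homeomorphic_map_between[OF hf' this] show False using n f'f ab by auto
    qed
    moreover have "f a \<noteq> f b" using f'f ab by metis
    ultimately obtain g where g: "simple_path g" "pathfinish g = pathstart g" "path_image g \<subseteq> ?S"
      using not_between_imp_simple_loop[OF connS lpc, of "f a" "f b"] ab by blast
    let ?C = "f' ` path_image g"
    have "homeomorphic_map (subtopology (top_of_set ?S) (path_image g)) (subtopology X ?C) f'"
    proof (rule homeomorphic_map_subtopologies[OF hf'])
      show "f' ` (topspace (top_of_set ?S) \<inter> path_image g) = topspace X \<inter> ?C"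
        using g(3) homeomorphic_imp_surjective_map[OF hf'] by auto
    qed
    then have "top_of_set (path_image g) homeomorphic_space subtopology X ?C"
      using g(3) homeomorphic_map_imp_homeomorphic_space by (fastforce simp: subtopology_subtopology Int_absorb1)
    moreover have "top_of_set (path_image g) homeomorphic_space top_of_set (sphere (0::complex) 1)"
    proof -
      obtain h k where "homeomorphism (path_image g) (sphere (0::complex) 1) h k"
        using homeomorphic_simple_path_image_circle[OF g(1,2), of 1 0] unfolding homeomorphic_def by auto
      then have "homeomorphic_maps (top_of_set (path_image g)) (top_of_set (sphere (0::complex) 1)) h k"
        by (auto simp: homeomorphic_maps_def homeomorphism_def continuous_map_in_subtopology)
      then show ?thesis unfolding homeomorphic_space_def by blast
    qed
    ultimately have "subtopology X ?C homeomorphic_space top_of_set (sphere (0::complex) 1)"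
      using homeomorphic_space_sym homeomorphic_space_trans by blast
    moreover have "?C \<subseteq> topspace X" using g(3) homeomorphic_imp_surjective_map[OF hf'] by auto
    ultimately show False using nc by (auto simp: simple_closed_curve_in_def)
  qed
qed


section \<open>The alternative\<close>

theorem theorem1p7:
  fixes G :: "('g, 'm) monoid_scheme"
    and X :: "'a topology"
    and \<phi> :: "'g \<Rightarrow> 'a \<Rightarrow> 'a"
  assumes "group G"
    and "dendrite X"
    and "acts_by_homeomorphisms G X \<phi>"
  shows "contains_nonabelian_free_subgroup G \<or> elementary_action G X \<phi>"
proof -
  interpret dendron_action X G \<phi>
    using dendrite_imp_dendron[OF assms(2)] assms(3)
    by (simp add: dendron_action_def dendron_action_axioms_def acts_by_homeomorphisms_def)
  show ?thesis
    using assms(2) by (intro free_subgroup_or_elementary) (simp add: dendrite_def continuum_space_def)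
qed

end
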